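(* Let $0<\alpha<1$ and consider the problem described in the context with the specific heat $c$ unknown (Case 1), the data $k,\rho,\ell>0$, $T_m$, $T_0>T_m$, $q_0>0$ being given. If $$\frac{k\rho\ell(T_0-T_m)\,\Gamma\left(1+\frac{\alpha}{2}\right)}{q_0^2\,\Gamma\left(1-\frac{\alpha}{2}\right)}<1,$$ then the equation $$\frac{1-W\left(-x;-\frac{\alpha}{2},1\right)}{x}=\frac{k\rho\ell(T_0-T_m)\,\Gamma\left(1+\frac{\alpha}{2}\right)}{q_0^2\,\Gamma^3\left(1-\frac{\alpha}{2}\right)}\,\frac{1}{M_{\alpha/2}(x)},\quad x>0,$$ has a unique solution $\xi_\alpha>0$, and the solution of Case 1 is given by $$c=c_\alpha=\frac{\ell\,\Gamma\left(1+\frac{\alpha}{2}\right)}{(T_0-T_m)\,\Gamma\left(1-\frac{\alpha}{2}\right)}\,\frac{\xi_\alpha}{M_{\alpha/2}(\xi_\alpha)}\left[1-W\left(-\xi_\alpha;-\frac{\alpha}{2},1\right)\right],$$ $$T_\alpha(x,t)=T_0-\frac{T_0-T_m}{1-W\left(-\xi_\alpha;-\frac{\alpha}{2},1\right)}\left[1-W\left(-\frac{x}{\lambda_\alpha t^{\alpha/2}};-\frac{\alpha}{2},1\right)\right],\qquad s_\alpha(t)=\lambda_\alpha\xi_\alpha t^{\alpha/2},$$ where $$\lambda_\alpha^2=\frac{k}{\rho c_\alpha}=\frac{k(T_0-T_m)\,\Gamma\left(1-\frac{\alpha}{2}\right)}{\rho\ell\,\Gamma\left(1+\frac{\alpha}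{2}\right)}\,\frac{M_{\alpha/2}(\xi_\alpha)}{\xi_\alpha\left[1-W\left(-\xi_\alpha;-\frac{\alpha}{2},1\right)\right]}.$$
   Context: For $0<\alpha<1$ the Caputo fractional derivative of a function $f$ of $t$ is $D^\alpha f(t)=\frac{1}{\Gamma(1-\alpha)}\int_0^t \frac{f'(\tau)}{(t-\tau)^\alpha}\,d\tau$, where $\Gamma$ is Euler's Gamma function. The Wright function is $W(z;a,b)=\sum_{n=0}^{\infty}\frac{z^n}{n!\,\Gamma(na+b)}$ for $z\in\mathbb{C}$, $a>-1$, $b\in\mathbb{R}$; the Mainardi function is $M_\nu(z)=W(-z;-\nu,1-\nu)$ for $\nu<1$. The problem: $\rho,k,c,\ell$ are positive constants (density, conductivity, specific heat, latent heat), $\lambda^2=k/(\rho c)$, $T_m$ is the melting temperature, $T_0>T_m$ and $q_0>0$ are constants. Find $x=s(t)$, $T=T(x,t)$ and the unknown coefficient such that: $D^\alpha T=\lambda^2 T_{xx}$ for $0<x<s(t)$, $t>0$ (Caputo derivative in $t$); $s(0)=0$; $T(x,0)=T(+\infty,t)=T_m$ for $x>0,t>0$; $T(s(t),t)=T_m$; $-kT_x(s(t),t)=\rho\ell\, D^\alpha s(t)$; $T(0,t)=T_0$; $kT_x(0,t)=-q_0/t^{\alpha/2}$, for all $t>0$.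
   Formalization: The conditions T(x,0)=T(+∞,t)=T_m are dropped, since the stated T_α violates them beyond x=s(t) (there T_α(+∞,t)<T_m); "the solution is given by" is read as: the explicit c_α, T_α, s_α solve the problem, without uniqueness among all solutions. *)

theory Defs
  imports "HOL-Analysis.Analysis"
begin

text \<open>Wright function W(z;a,b) = sum z^n/(n! Gamma(n a + b)); 1/Gamma is rGamma
  (the entire reciprocal Gamma function, zero at the poles of Gamma).\<close>
definition wright :: "real \<Rightarrow> real \<Rightarrow> real \<Rightarrow> real" where
  "wright z a b = (\<Sum>n. z ^ n / fact n * rGamma (real n * a + b))"

definition mainardi :: "real \<Rightarrow> real \<Rightarrow> real" where
  "mainardi \<nu> z = wright (- z) (- \<nu>) (1 - \<nu>)"

definition caputo :: "real \<Rightarrow> (real \<Rightarrow> real) \<Rightarrow> real \<Rightarrow> real" where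
  "caputo \<alpha> f t = integral {0..t} (\<lambda>\<tau>. deriv f \<tau> / (t - \<tau>) powr \<alpha>) / Gamma (1 - \<alpha>)"

definition caputo_exists :: "real \<Rightarrow> (real \<Rightarrow> real) \<Rightarrow> real \<Rightarrow> bool" where
  "caputo_exists \<alpha> f t \<longleftrightarrow>
     (\<forall>\<tau>\<in>{0<..<t}. f differentiable (at \<tau>)) \<and>
     (\<lambda>\<tau>. deriv f \<tau> / (t - \<tau>) powr \<alpha>) integrable_on {0..t}"

definition stefan_sol ::
  "real \<Rightarrow> real \<Rightarrow> real \<Rightarrow> real \<Rightarrow> real \<Rightarrow> real \<Rightarrow> real \<Rightarrow> real
   \<Rightarrow> (real \<Rightarrow> real \<Rightarrow> real) \<Rightarrow> (real \<Rightarrow> real) \<Rightarrow> bool" where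
  "stefan_sol \<alpha> \<rho> k c L Tm T0 q0 T s \<longleftrightarrow>
     c > 0 \<and> s 0 = 0 \<and>
     (\<forall>t>0. \<forall>x. 0 < x \<and> x < s t \<longrightarrow>
        caputo_exists \<alpha> (\<lambda>\<tau>. T x \<tau>) t \<and>
        (\<forall>y\<in>{0<..<s t}. (\<lambda>z. T z t) differentiable (at y)) \<and>
        (\<lambda>y. deriv (\<lambda>z. T z t) y) differentiable (at x) \<and>
        caputo \<alpha> (\<lambda>\<tau>. T x \<tau>) t = k / (\<rho> * c) * deriv (\<lambda>y. deriv (\<lambda>z. T z t) y) x) \<and>
     (\<forall>t>0. T (s t) t = Tm) \<and>
     (\<forall>t>0. caputo_exists \<alpha> s t \<and> (\<lambda>z. T z t) differentiable (at (s t)) \<and>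
        - k * deriv (\<lambda>z. T z t) (s t) = \<rho> * L * caputo \<alpha> s t) \<and>
     (\<forall>t>0. T 0 t = T0) \<and>
     (\<forall>t>0. (\<lambda>z. T z t) differentiable (at 0) \<and>
        k * deriv (\<lambda>z. T z t) 0 = - q0 / t powr (\<alpha> / 2))"

end

theory Submission
  imports Defs "HOL-Complex_Analysis.Complex_Analysis" "HOL-Real_Asymp.Real_Asymp"
begin

text \<open>
  With \<open>\<nu> = \<alpha>/2\<close>, the function \<open>t\<^sup>b\<^sup>-\<^sup>1 W(-x t\<^sup>-\<^sup>\<nu>; -\<nu>, b)\<close> is for \<open>t > 0\<close> the inverse Fourier transform of
  \<open>(i\<eta>)\<^sup>-\<^sup>b exp(-x (i\<eta>)\<^sup>\<nu>)\<close>, as termwise integration of the exponential series shows, and the same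
  transform vanishes for \<open>t < 0\<close>. By this causality the Abel integral of order \<open>b\<close> of the function with parameter \<open>0\<close>
  is the function with parameter \<open>b\<close>; for \<open>b = 1 - \<alpha>\<close> this says that \<open>w(x t\<^sup>-\<^sup>\<nu>)\<close> with \<open>w(x) = W(-x; -\<nu>, 1)\<close>
  solves the fractional diffusion equation.

  In the similarity variable that equation expresses \<open>w''(x)\<close> by an integral of \<open>w'\<close> over \<open>[x, \<infinity>)\<close>,
  and yields a maximum principle: \<open>w'' > 0\<close> wherever \<open>w\<close> attains a maximum over \<open>[x, \<infinity>)\<close> above its
  limit at infinity. Hence \<open>w\<close> decreases to that limit, the Mainardi function \<open>M = -w'\<close>
  is nonnegative and, applying the principle at every point, strictly decreasing and positive. Then
  \<open>(1 - w(x)) M(x) / x\<close> decreases strictly from \<open>1/\<Gamma>(1-\<nu>)\<^sup>2\<close> to \<open>0\<close>, which gives the unique root;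
  the remaining conditions are algebraic consequences of the equation for \<open>\<xi>\<close>.
\<close>

section \<open>Gamma integrals with complex scaling\<close>

text \<open>Leaving out the endpoint keeps \<open>r > 0\<close> on the whole space, so powr
  identities need no special case at 0, and Fubini runs on the half-line without indicators.\<close>

definition lborel_pos :: "real measure" where
  "lborel_pos = restrict_space lborel {0<..}"

lemma space_lborel_pos [simp]: "space lborel_pos = {0<..}"
  by (simp add: lborel_pos_def space_restrict_space)

lemma lborel_pos_measurable [measurable (raw)]:
  assumes "f \<in> borel_measurable borel"
  shows "f \<in> borel_measurable lborel_pos"
  using assms by (auto simp: lborel_pos_def intro: measurable_restrict_space1)

lemma sigma_finite_lborel_pos: "sigma_finite_measure lborel_pos"
  unfolding lborel_pos_def
  by (rule sigma_finite_measure_restrict_space) (auto intro: lborel.sigma_finite_measure_axioms)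

lemma has_bochner_integral_lborel_pos:
  fixes f :: "real \<Rightarrow> 'a::{banach, second_countable_topology}"
  assumes "has_bochner_integral lborel (\<lambda>x. indicator {0<..} x *\<^sub>R f x) c"
  shows "has_bochner_integral lborel_pos f c"
  using assms unfolding lborel_pos_def
  by (auto simp: has_bochner_integral_iff integrable_restrict_space integral_restrict_space
      set_integrable_def set_lebesgue_integral_def)

lemma has_bochner_integral_lborel_pos_nonneg:
  fixes f :: "real \<Rightarrow> real"
  assumes "f \<in> borel_measurable borel" "\<And>x. f x \<ge> 0" "(f has_integral c) {0<..}"
  shows "has_bochner_integral lborel_pos f c"
proof (rule has_bochner_integral_lborel_pos, rule has_bochner_integral_nn_integral)
  show "(\<integral>\<^sup>+ x. ennreal (indicator {0<..} x *\<^sub>R f x) \<partial>lborel) = ennreal c"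
    using nn_integral_has_integral_lebesgue[OF _ assms(3)] assms(2) by simp
  show "0 \<le> c" using has_integral_nonneg[OF assms(3)] assms(2) by simp
qed (use assms in auto)

text \<open>Substitute \<open>t = a * r\<close> in Euler's integral; the affine change of variables
  supplies a factor \<open>1 / a\<close>, the constant \<open>a powr (1 - \<beta>)\<close> the
  rest.\<close>

lemma has_bochner_integral_Gamma:
  assumes "\<beta> > 0" "a > 0"
  shows "has_bochner_integral lborel_pos (\<lambda>r. r powr (\<beta> - 1) * exp (- (a * r)))
    (Gamma \<beta> * a powr (- \<beta>) :: real)"
proof -
  let ?h = "\<lambda>t. indicator {0..} t * t powr (\<beta> - 1) / exp t"
  have "has_bochner_integral lborel ?h (Gamma \<beta>)"
    using Gamma_conv_nn_integral_real[OF assms(1)] assms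
    by (intro has_bochner_integral_nn_integral)
       (auto simp: Gamma_real_pos less_imp_le indicator_def)
  from this have "has_bochner_integral lborel (\<lambda>t. ?h (0 + a * t)) (Gamma \<beta> /\<^sub>R \<bar>a\<bar>)"
    using assms by (subst (asm) lborel_has_bochner_integral_real_affine_iff[where c = a and t = 0]) auto
  from has_bochner_integral_mult_left[OF this, of "a powr (1 - \<beta>)"]
  have 1: "has_bochner_integral lborel (\<lambda>t. ?h (0 + a * t) * a powr (1 - \<beta>)) (Gamma \<beta> /\<^sub>R \<bar>a\<bar> * a powr (1 - \<beta>))"
    using assms by simp
  have 2: "Gamma \<beta> /\<^sub>R \<bar>a\<bar> * a powr (1 - \<beta>) = Gamma \<beta> * a powr (- \<beta>)"
    using assms by (simp add: powr_diff powr_minus field_simps)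
  have 3: "?h (0 + a * t) * a powr (1 - \<beta>)
      = indicator {0<..} t *\<^sub>R (t powr (\<beta> - 1) * exp (- (a * t)))" for t
  proof (cases "t > 0")
    case True
    have "a powr (\<beta> - 1) * a powr (1 - \<beta>) = 1"
      using assms by (simp flip: powr_add)
    then show ?thesis using True assms by (simp add: powr_mult exp_minus field_simps)
  next
    case False
    then have "t < 0 \<or> t = 0" by auto
    then show ?thesis
      using assms by (auto simp: indicator_def zero_le_mult_iff)
  qed
  show ?thesis
    by (rule has_bochner_integral_lborel_pos) (use 1 in \<open>simp only: 2 3\<close>)
qed

text \<open>Identifies the coefficients produced by termwise Gamma integration with those of the
  binomial series of \<open>(1 - z) powr (- \<beta>)\<close>.\<close>

lemma gbinomial_neg_Gamma:
  assumes "\<beta> > (0::real)"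
  shows "((- \<beta>) gchoose n) * (- 1) ^ n = Gamma (\<beta> + real n) / (Gamma \<beta> * fact n)"
proof -
  have "pochhammer \<beta> n = Gamma (\<beta> + real n) / Gamma \<beta>"
    using assms by (intro pochhammer_Gamma) (auto dest: nonpos_Ints_nonpos)
  moreover have "((- \<beta>) gchoose n) = (- 1) ^ n * pochhammer \<beta> n / fact n"
    by (simp add: gbinomial_pochhammer)
  ultimately show ?thesis by (simp add: field_simps flip: power_mult_distrib)
qed

lemma has_bochner_integral_Gamma_complex:
  fixes s :: complex
  assumes "\<beta> > 0" "Re s > 0"
  shows "has_bochner_integral lborel_pos (\<lambda>r. complex_of_real (r powr (\<beta> - 1)) * exp (- (s * of_real r)))
    (of_real (Gamma \<beta>) * s powr (- of_real \<beta>))"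
proof -
  \<comment> \<open>Expanding \<open>exp ((a - s) r)\<close> and integrating termwise gives a binomial series in \<open>(a - s) / a\<close>; it converges
    because the disc of radius \<open>a\<close> around a large real \<open>a\<close> contains \<open>s\<close>.\<close>
  define a where "a = (cmod s)\<^sup>2 / Re s"
  have s0: "s \<noteq> 0" using assms by auto
  have a: "a > 0" using assms s0 by (simp add: a_def)
  have "(cmod (of_real a - s))\<^sup>2 = (cmod s)\<^sup>2 - 2 * a * Re s + a\<^sup>2"
    unfolding cmod_power2 by (simp add: power2_eq_square algebra_simps)
  \<comment> \<open>By the choice of \<open>a\<close>, \<open>a * Re s\<close> is
    \<open>(cmod s)\<^sup>2\<close>, so the left side is
    \<open>a\<^sup>2 - (cmod s)\<^sup>2\<close>.\<close>
  also have "\<dots> < a\<^sup>2" using assms s0 by (simp add: a_def)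
  finally have "cmod (of_real a - s) < a" using a by (simp add: power2_less_imp_less)
  define z where "z = (of_real a - s) / of_real a"
  have z: "cmod z < 1"
    using \<open>cmod (of_real a - s) < a\<close> a by (simp add: z_def norm_divide)
  define f where "f = (\<lambda>n r. of_real (r powr (\<beta> - 1) * exp (- (a * r))) * ((of_real a - s) * of_real r) ^ n /\<^sub>R fact n)"
  define g where "g = (\<lambda>n. Gamma (\<beta> + real n) / fact n * a powr (- (\<beta> + real n)))"
  have int: "has_bochner_integral lborel_pos (f n) (of_real (g n) * (of_real a - s) ^ n)"
    and int': "has_bochner_integral lborel_pos (\<lambda>r. norm (f n r)) (g n * cmod (of_real a - s) ^ n)" for n
  proof -
    have *: "has_bochner_integral lborel_pos (\<lambda>r. r powr (\<beta> + real n - 1) * exp (- (a * r)))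
      (Gamma (\<beta> + real n) * a powr (- (\<beta> + real n)))"
      using assms a by (intro has_bochner_integral_Gamma) auto
    have e: "r powr (\<beta> + real n - 1) = r powr (\<beta> - 1) * r ^ n" if "r > 0" for r :: real
      using that by (simp add: powr_add powr_diff powr_realpow)
    have "has_bochner_integral lborel_pos (\<lambda>r. of_real (r powr (\<beta> + real n - 1) * exp (- (a * r))) * ((of_real a - s) ^ n / fact n))
      (of_real (Gamma (\<beta> + real n) * a powr (- (\<beta> + real n))) * ((of_real a - s) ^ n / fact n))"
      by (rule has_bochner_integral_mult_left)
         (rule has_bochner_integral_of_real[OF *])
    moreover have "of_real (r powr (\<beta> + real n - 1) * exp (- (a * r))) * ((of_real a - s) ^ n / fact n) = f n r"
      if "r \<in> space lborel_pos" for r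
      using that unfolding f_def by (subst e) (simp_all add: power_mult_distrib scaleR_conv_of_real divide_inverse ac_simps)
    moreover have "of_real (Gamma (\<beta> + real n) * a powr (- (\<beta> + real n))) * ((of_real a - s) ^ n / fact n)
      = of_real (g n) * (of_real a - s) ^ n"
      by (simp add: g_def)
    ultimately show "has_bochner_integral lborel_pos (f n) (of_real (g n) * (of_real a - s) ^ n)"
      using has_bochner_integral_cong by (metis (no_types, lifting))
    have "has_bochner_integral lborel_pos (\<lambda>r. r powr (\<beta> + real n - 1) * exp (- (a * r)) * (cmod (of_real a - s) ^ n / fact n))
      (Gamma (\<beta> + real n) * a powr (- (\<beta> + real n)) * (cmod (of_real a - s) ^ n / fact n))"
      by (rule has_bochner_integral_mult_left) (rule *)
    moreover have "r powr (\<beta> + real n - 1) * exp (- (a * r)) * (cmod (of_real a - s) ^ n / fact n) = norm (f n r)"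
      if "r \<in> space lborel_pos" for r
      using that unfolding f_def
      by (subst e) (simp_all add: norm_mult norm_power power_mult_distrib divide_inverse ac_simps)
    moreover have "Gamma (\<beta> + real n) * a powr (- (\<beta> + real n)) * (cmod (of_real a - s) ^ n / fact n)
      = g n * cmod (of_real a - s) ^ n"
      by (simp add: g_def)
    ultimately show "has_bochner_integral lborel_pos (\<lambda>r. norm (f n r)) (g n * cmod (of_real a - s) ^ n)"
      using has_bochner_integral_cong by (metis (no_types, lifting))
  qed
  have ap: "a powr (- (\<beta> + real n)) = a powr (- \<beta>) / a ^ n" for n
  proof -
    have "a powr (- \<beta> - real n) = a powr (- \<beta>) / a ^ n"
      using a by (simp only: powr_diff powr_realpow)
    then show ?thesis by simp
  qed
  have gG: "g n = Gamma \<beta> * a powr (- \<beta>) * (((- \<beta>) gchoose n) * (- 1) ^ n) / a ^ n" for n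
  proof -
    have "Gamma \<beta> \<noteq> 0" using assms by (simp add: Gamma_real_pos less_imp_neq[THEN not_sym])
    then show ?thesis
      unfolding g_def ap gbinomial_neg_Gamma[OF assms(1)] by simp
  qed
  have sgn: "(- y / b) ^ n = (- 1) ^ n * (y ^ n / b ^ n)" for n and y b :: "'b::field"
    by (metis mult_minus1 power_divide power_mult_distrib times_divide_eq_right)
  have gb: "g n * y ^ n = Gamma \<beta> * a powr (- \<beta>) * (((- \<beta>) gchoose n) * (- y / a) ^ n)" for n and y :: real
    unfolding gG sgn by simp
  have gc: "of_real (g n) * y ^ n = of_real (Gamma \<beta> * a powr (- \<beta>)) * ((- of_real \<beta> gchoose n) * (- y / of_real a) ^ n)"
    for n and y :: complex
  proof -
    have "complex_of_real ((- \<beta>) gchoose n) = (- of_real \<beta> gchoose n)"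
      by (simp add: gbinomial_prod_rev)
    then show ?thesis unfolding gG sgn by simp
  qed
  have "summable (\<lambda>n. g n * cmod (of_real a - s) ^ n)"
    unfolding gb using gen_binomial_real[of "- cmod (of_real a - s) / a" "- \<beta>"] \<open>cmod (of_real a - s) < a\<close> a
    by (intro summable_mult) (auto simp: sums_iff)
  then have sm: "summable (\<lambda>n. \<integral>r. norm (f n r) \<partial>lborel_pos)"
    using int' by (simp add: has_bochner_integral_iff)
  have fs: "(\<lambda>n. f n r) sums (of_real (r powr (\<beta> - 1)) * exp (- (s * of_real r)))" for r
  proof -
    have "(\<lambda>n. of_real (r powr (\<beta> - 1) * exp (- (a * r))) * (((of_real a - s) * of_real r) ^ n /\<^sub>R fact n)) sums
       (of_real (r powr (\<beta> - 1) * exp (- (a * r))) * exp ((of_real a - s) * of_real r))"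
      by (intro sums_mult exp_converges)
    moreover have "of_real (exp (- (a * r))) * exp ((of_real a - s) * of_real r) = exp (- (s * of_real r))"
      by (simp flip: exp_of_real exp_add add: algebra_simps)
    ultimately show ?thesis by (simp add: f_def mult.assoc)
  qed
  have fn: "summable (\<lambda>n. norm (f n r))" for r
  proof -
    have "summable (\<lambda>n. norm (complex_of_real (r powr (\<beta> - 1) * exp (- (a * r)))) * norm (((of_real a - s) * of_real r) ^ n /\<^sub>R fact n))"
      by (intro summable_mult summable_norm_exp)
    then show ?thesis unfolding f_def mult_scaleR_right[symmetric] norm_mult .
  qed
  have i: "integrable lborel_pos (f n)" for n using int by (simp add: has_bochner_integral_iff)
  note S = integrable_suminf[OF i _ sm] sums_integral[OF i _ sm]
  have 1: "integrable lborel_pos (\<lambda>r. of_real (r powr (\<beta> - 1)) * exp (- (s * of_real r)))"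
    using S(1) fn fs by (simp add: sums_iff)
  have 2: "(\<lambda>n. of_real (g n) * (of_real a - s) ^ n) sums
       (\<integral>r. of_real (r powr (\<beta> - 1)) * exp (- (s * of_real r)) \<partial>lborel_pos)"
    using S(2) fn fs int by (simp add: sums_iff has_bochner_integral_iff)
  have "(\<lambda>n. (- of_real \<beta> gchoose n) * (- z) ^ n) sums ((1 + (- z)) powr (- of_real \<beta>))"
    using z by (intro gen_binomial_complex) auto
  then have 3: "(\<lambda>n. of_real (g n) * (of_real a - s) ^ n) sums
      (of_real (Gamma \<beta> * a powr (- \<beta>)) * ((1 + (- z)) powr (- of_real \<beta>)))"
    unfolding gc z_def minus_divide_left by (intro sums_mult)
  have e: "of_real a * (1 + (- z)) = s" using a by (simp add: z_def field_simps)
  \<comment> \<open>A positive real factor splits off a complex power without crossing the branch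
    cut, so the binomial sum becomes a power of \<open>s\<close> itself.\<close>
  have "(of_real a * (1 + (- z))) powr (- of_real \<beta>) = of_real a powr (- of_real \<beta>) * (1 + (- z)) powr (- of_real \<beta>)"
    using a by (intro powr_times_real_left) auto
  then have "s powr (- of_real \<beta>) = of_real a powr (- of_real \<beta>) * (1 + (- z)) powr (- of_real \<beta>)"
    by (simp only: e)
  moreover have "complex_of_real a powr (- of_real \<beta>) = of_real (a powr (- \<beta>))"
    using a powr_of_real[of a "- \<beta>"] by simp
  ultimately have "s powr (- of_real \<beta>) = of_real (a powr (- \<beta>)) * (1 + (- z)) powr (- of_real \<beta>)"
    by simp
  with sums_unique2[OF 2 3] 1 show ?thesis
    by (simp add: has_bochner_integral_iff mult.assoc)
qed

section \<open>Growth of Gamma and the transform of \<open>exp (y * r powr \<nu>)\<close>\<close>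

lemma Gamma_plus_le_powr:
  fixes x s :: real
  assumes "x > 0" "0 \<le> s" "s \<le> 1"
  shows "Gamma (x + s) \<le> Gamma x * x powr s"
proof -
  \<comment> \<open>\<open>ln \<circ> Gamma\<close> is convex and \<open>x + s\<close> lies between
    \<open>x\<close> and \<open>x + 1\<close> with weight \<open>s\<close>; the functional equation
    then leaves only \<open>s * ln x\<close>.\<close>
  have "(ln \<circ> Gamma) ((1 - s) *\<^sub>R x + s *\<^sub>R (x + 1)) \<le> (1 - s) * (ln \<circ> Gamma) x + s * (ln \<circ> Gamma) (x + 1)"
    using assms by (intro convex_onD[OF log_convex_Gamma_real]) auto
  moreover have "(1 - s) *\<^sub>R x + s *\<^sub>R (x + 1) = x + s" by (simp add: algebra_simps)
  moreover have "Gamma (x + 1) = x * Gamma x" using assms by (intro Gamma_plus1) (auto dest: nonpos_Ints_nonpos)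
  ultimately have "ln (Gamma (x + s)) \<le> ln (Gamma x * x powr s)"
    using assms Gamma_real_pos[of x] by (simp add: ln_mult ln_powr algebra_simps less_imp_neq[THEN not_sym])
  then show ?thesis using assms by (simp add: Gamma_real_pos)
qed

text \<open>Ratio test: by \<open>Gamma_plus_le_powr\<close> with shift \<nu>, consecutive terms
  eventually have ratio at most
  \<open>\<bar>y\<bar> * (\<nu> * n + \<beta>) powr \<nu> / (n + 1)\<close>, which tends to 0
  because \<open>\<nu> < 1\<close>.\<close>

lemma summable_Gamma_over_fact:
  fixes y \<nu> \<beta> :: real
  assumes "0 < \<nu>" "\<nu> < 1"
  shows "summable (\<lambda>n. \<bar>y\<bar> ^ n / fact n * Gamma (\<nu> * real n + \<beta>))"
proof -
  have "((\<lambda>n. (\<nu> * real n + \<beta>) powr \<nu> / (real n + 1)) \<longlongrightarrow> 0) sequentially"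
    using assms by real_asymp
  from tendsto_mult_left[OF this, of "\<bar>y\<bar>"] have "eventually (\<lambda>n. \<bar>y\<bar> * ((\<nu> * real n + \<beta>) powr \<nu> / (real n + 1)) < 1/2) sequentially"
    by (intro order_tendstoD(2)) auto
  moreover have "eventually (\<lambda>n. \<nu> * real n + \<beta> > 0) sequentially"
    using assms by real_asymp
  ultimately obtain N where N: "\<And>n. n \<ge> N \<Longrightarrow> \<bar>y\<bar> * ((\<nu> * real n + \<beta>) powr \<nu> / (real n + 1)) < 1/2"
     "\<And>n. n \<ge> N \<Longrightarrow> \<nu> * real n + \<beta> > 0"
    unfolding eventually_sequentially by (metis (full_types) le_trans nle_le)
  show ?thesis
  proof (rule summable_ratio_test[of "1/2" N])
    fix n assume n: "n \<ge> N"
    define z where "z = \<nu> * real n + \<beta>"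
    have z: "z > 0" "\<bar>y\<bar> * (z powr \<nu> / (real n + 1)) < 1/2"
      using N[OF n] by (auto simp: z_def)
    have eq: "\<nu> * real (Suc n) + \<beta> = z + \<nu>" by (simp add: z_def algebra_simps)
    have "\<bar>y\<bar> ^ Suc n / fact (Suc n) * Gamma (z + \<nu>) \<le> \<bar>y\<bar> ^ Suc n / fact (Suc n) * (Gamma z * z powr \<nu>)"
      using z assms by (intro mult_left_mono Gamma_plus_le_powr) auto
    also have "\<dots> = (\<bar>y\<bar> * (z powr \<nu> / (real n + 1))) * (\<bar>y\<bar> ^ n / fact n * Gamma z)"
      by (simp add: field_simps)
    also have "\<dots> \<le> 1/2 * (\<bar>y\<bar> ^ n / fact n * Gamma z)"
      using z by (intro mult_right_mono) (auto simp: Gamma_real_pos less_imp_le)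
    finally have "\<bar>y\<bar> ^ Suc n / fact (Suc n) * Gamma (z + \<nu>) \<le> 1/2 * (\<bar>y\<bar> ^ n / fact n * Gamma z)" .
    moreover have "Gamma z > 0" "Gamma (z + \<nu>) > 0" using z assms by auto
    ultimately show "norm (\<bar>y\<bar> ^ Suc n / fact (Suc n) * Gamma (\<nu> * real (Suc n) + \<beta>)) \<le> 1/2 * norm (\<bar>y\<bar> ^ n / fact n * Gamma (\<nu> * real n + \<beta>))"
      unfolding eq z_def[symmetric] by (simp add: abs_mult del: power_Suc fact_Suc)
  qed simp
qed

lemma powr_minus_affine:
  fixes s :: real
  assumes "s > 0"
  shows "s powr (- (\<nu> * real n + \<beta>)) = s powr (- \<beta>) * (s powr (- \<nu>)) ^ n"
proof -
  have "(s powr (- \<nu>)) ^ n = s powr (- \<nu> * real n)"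
    using assms by (simp add: powr_powr flip: powr_realpow)
  moreover have "- (\<nu> * real n + \<beta>) = - \<beta> + - \<nu> * real n" by simp
  ultimately show ?thesis by (simp only: powr_add)
qed

text \<open>Expand \<open>exp (y * r powr \<nu>)\<close> and integrate each power by the complex
  Gamma integral. The norms integrate to the same series with \<open>cmod y\<close> and
  \<open>Re s\<close>, which is summable for every \<open>y\<close>; this justifies the
  exchange.\<close>

lemma exp_powr_transform:
  fixes s y :: complex
  assumes "0 < \<nu>" "\<nu> < 1" "\<beta> > 0" "Re s > 0"
  shows "integrable lborel_pos (\<lambda>r. of_real (r powr (\<beta> - 1)) * exp (- (s * of_real r)) * exp (y * of_real (r powr \<nu>)))"
    and "(\<lambda>n. y ^ n / fact n * of_real (Gamma (\<nu> * real n + \<beta>)) * s powr (- of_real (\<nu> * real n + \<beta>))) sums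
      (\<integral>r. of_real (r powr (\<beta> - 1)) * exp (- (s * of_real r)) * exp (y * of_real (r powr \<nu>)) \<partial>lborel_pos)"
proof -
  define f where "f = (\<lambda>n r. of_real (r powr (\<beta> - 1)) * exp (- (s * of_real r)) * (y * of_real (r powr \<nu>)) ^ n /\<^sub>R fact n)"
  have pos: "\<nu> * real n + \<beta> > 0" for n using assms by (simp add: add_nonneg_pos)
  have e: "r powr (\<nu> * real n + \<beta> - 1) = r powr (\<beta> - 1) * (r powr \<nu>) ^ n" if "r > 0" for n and r :: real
  proof -
    have "(r powr \<nu>) ^ n = r powr (\<nu> * real n)"
      using that by (simp add: powr_powr flip: powr_realpow)
    then show ?thesis by (simp add: algebra_simps flip: powr_add)
  qed
  have int: "has_bochner_integral lborel_pos (f n)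
     (y ^ n / fact n * (of_real (Gamma (\<nu> * real n + \<beta>)) * s powr (- of_real (\<nu> * real n + \<beta>))))" for n
  proof -
    have "has_bochner_integral lborel_pos (\<lambda>r. y ^ n / fact n * (of_real (r powr (\<nu> * real n + \<beta> - 1)) * exp (- (s * of_real r))))
      (y ^ n / fact n * (of_real (Gamma (\<nu> * real n + \<beta>)) * s powr (- of_real (\<nu> * real n + \<beta>))))"
      by (rule has_bochner_integral_mult_right) (rule has_bochner_integral_Gamma_complex[OF pos assms(4)])
    moreover have "y ^ n / fact n * (of_real (r powr (\<nu> * real n + \<beta> - 1)) * exp (- (s * of_real r))) = f n r"
      if "r \<in> space lborel_pos" for r
      using that unfolding f_def
      by (subst e) (simp_all add: power_mult_distrib scaleR_conv_of_real divide_inverse ac_simps)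
    ultimately show ?thesis
      using has_bochner_integral_cong by (metis (no_types, lifting))
  qed
  have int': "has_bochner_integral lborel_pos (\<lambda>r. norm (f n r))
     (cmod y ^ n / fact n * (Gamma (\<nu> * real n + \<beta>) * Re s powr (- (\<nu> * real n + \<beta>))))" for n
  proof -
    have "has_bochner_integral lborel_pos (\<lambda>r. cmod y ^ n / fact n * (r powr (\<nu> * real n + \<beta> - 1) * exp (- (Re s * r))))
      (cmod y ^ n / fact n * (Gamma (\<nu> * real n + \<beta>) * Re s powr (- (\<nu> * real n + \<beta>))))"
      by (rule has_bochner_integral_mult_right) (rule has_bochner_integral_Gamma[OF pos assms(4)])
    moreover have "cmod y ^ n / fact n * (r powr (\<nu> * real n + \<beta> - 1) * exp (- (Re s * r))) = norm (f n r)"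
      if "r \<in> space lborel_pos" for r
      using that unfolding f_def
      by (subst e) (simp_all add: norm_mult norm_power power_mult_distrib divide_inverse ac_simps)
    ultimately show ?thesis
      using has_bochner_integral_cong by (metis (no_types, lifting))
  qed
  have "summable (\<lambda>n. Re s powr (- \<beta>) * (\<bar>cmod y * Re s powr (- \<nu>)\<bar> ^ n / fact n * Gamma (\<nu> * real n + \<beta>)))"
    using assms by (intro summable_mult summable_Gamma_over_fact)
  then have "summable (\<lambda>n. (cmod y ^ n / fact n * (Gamma (\<nu> * real n + \<beta>) * Re s powr (- (\<nu> * real n + \<beta>)))))"
    unfolding powr_minus_affine[OF assms(4)] by (simp add: abs_mult power_mult_distrib ac_simps)
  then have sm: "summable (\<lambda>n. \<integral>r. norm (f n r) \<partial>lborel_pos)"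
    using int' by (simp add: has_bochner_integral_iff)
  have fs: "(\<lambda>n. f n r) sums (of_real (r powr (\<beta> - 1)) * exp (- (s * of_real r)) * exp (y * of_real (r powr \<nu>)))" for r
  proof -
    have "(\<lambda>n. of_real (r powr (\<beta> - 1)) * exp (- (s * of_real r)) * ((y * of_real (r powr \<nu>)) ^ n /\<^sub>R fact n)) sums
       (of_real (r powr (\<beta> - 1)) * exp (- (s * of_real r)) * exp (y * of_real (r powr \<nu>)))"
      by (intro sums_mult exp_converges)
    then show ?thesis by (simp add: f_def mult.assoc)
  qed
  have fn: "summable (\<lambda>n. norm (f n r))" for r
  proof -
    have "summable (\<lambda>n. norm (of_real (r powr (\<beta> - 1)) * exp (- (s * of_real r))) * norm ((y * of_real (r powr \<nu>)) ^ n /\<^sub>R fact n))"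
      by (intro summable_mult summable_norm_exp)
    then show ?thesis unfolding f_def mult_scaleR_right[symmetric] norm_mult .
  qed
  have i: "integrable lborel_pos (f n)" for n using int by (simp add: has_bochner_integral_iff)
  note S = integrable_suminf[OF i _ sm] sums_integral[OF i _ sm]
  show "integrable lborel_pos (\<lambda>r. of_real (r powr (\<beta> - 1)) * exp (- (s * of_real r)) * exp (y * of_real (r powr \<nu>)))"
    using S(1) fn fs by (simp add: sums_iff)
  show "(\<lambda>n. y ^ n / fact n * of_real (Gamma (\<nu> * real n + \<beta>)) * s powr (- of_real (\<nu> * real n + \<beta>))) sums
      (\<integral>r. of_real (r powr (\<beta> - 1)) * exp (- (s * of_real r)) * exp (y * of_real (r powr \<nu>)) \<partial>lborel_pos)"
    using S(2) fn fs int by (simp add: sums_iff has_bochner_integral_iff mult.assoc)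
qed

lemma integrable_exp_powr:
  fixes c :: real
  assumes "0 < \<nu>" "\<nu> < 1" "\<beta> > 0" "c > 0"
  shows "integrable lborel_pos (\<lambda>r. r powr (\<beta> - 1) * exp (- (c * r powr \<nu>)))"
proof -
  have "((\<lambda>r. r powr (\<beta> + 1) * exp (- (c * r powr \<nu>))) \<longlongrightarrow> 0) at_top"
    using assms by real_asymp
  then have "eventually (\<lambda>r. r powr (\<beta> + 1) * exp (- (c * r powr \<nu>)) < 1) at_top"
    by (rule order_tendstoD(2)) simp
  from eventually_conj[OF this eventually_gt_at_top[of 1]]
  obtain N where N: "\<And>r. r \<ge> N \<Longrightarrow> r powr (\<beta> + 1) * exp (- (c * r powr \<nu>)) < 1" "N > 1"
    by (auto simp: eventually_at_top_linorder)
  \<comment> \<open>Majorant: up to \<open>N\<close> the exponential is at most 1; beyond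
    \<open>N\<close> it absorbs \<open>r powr (\<beta> + 1)\<close>, which leaves the integrable
    tail \<open>r powr (- 2)\<close>.\<close>
  define D where "D = (\<lambda>r::real. if r \<le> N then r powr (\<beta> - 1) else r powr (- 2))"
  have "((\<lambda>r. r powr (\<beta> - 1)) has_integral (N powr (\<beta> - 1 + 1) / (\<beta> - 1 + 1))) {0..N}"
    using assms N by (intro has_integral_powr_from_0) auto
  then have "(D has_integral (N powr (\<beta> - 1 + 1) / (\<beta> - 1 + 1))) {0<..N}"
    by (subst has_integral_spike_set_eq[of _ "{0..N}"])
       (auto simp: D_def intro: negligible_subset[of "{0}"] elim: has_integral_eq[rotated])
  moreover have "((\<lambda>r. r powr (- 2)) has_integral -(N powr (- 2 + 1)) / (- 2 + 1)) {N..}"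
    using N by (intro has_integral_powr_to_inf) auto
  then have "(D has_integral -(N powr (- 2 + 1)) / (- 2 + 1)) {N..}"
    by (rule has_integral_spike_finite[of "{N}", rotated 2]) (auto simp: D_def)
  ultimately have "(D has_integral (N powr (\<beta> - 1 + 1) / (\<beta> - 1 + 1) + -(N powr (- 2 + 1)) / (- 2 + 1))) ({0<..N} \<union> {N..})"
    by (rule has_integral_Un) (auto intro: negligible_subset[of "{N}"])
  moreover have "{0<..N} \<union> {N..} = {0<..}" using N by auto
  ultimately have "integrable lborel_pos D"
    using has_bochner_integral_lborel_pos_nonneg[of D] by (auto simp: D_def has_bochner_integral_iff)
  then show ?thesis
  proof (rule Bochner_Integration.integrable_bound)
    show "AE r in lborel_pos. norm (r powr (\<beta> - 1) * exp (- (c * r powr \<nu>))) \<le> norm (D r)"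
    proof (rule AE_I2)
      fix r assume "r \<in> space lborel_pos"
      then have r: "r > 0" by simp
      show "norm (r powr (\<beta> - 1) * exp (- (c * r powr \<nu>))) \<le> norm (D r)"
      proof (cases "r \<le> N")
        case True
        then show ?thesis using r assms by (simp add: D_def mult_left_le)
      next
        case False
        have "r powr (\<beta> - 1) * exp (- (c * r powr \<nu>)) = r powr (- 2) * (r powr (\<beta> + 1) * exp (- (c * r powr \<nu>)))"
          by (simp flip: powr_add mult.assoc)
        also have "\<dots> \<le> r powr (- 2) * 1"
          using N(1)[of r] False by (intro mult_left_mono) auto
        finally show ?thesis using False by (simp add: D_def)
      qed
    qed
  qed measurable
qed

text \<open>Boundary values on the imaginary axis, approached through points with real part
  \<open>1 / (k + 1)\<close>. The sums converge by Tannery's theorem, as all these points have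
  modulus at least \<open>\<bar>\<tau>\<bar>\<close>; the integrals converge by domination, as
  \<open>Re y < 0\<close> supplies the decay that \<open>exp (- (s * r))\<close> loses in the
  limit.\<close>

lemma exp_powr_transform_boundary:
  fixes y :: complex and \<tau> :: real
  assumes "0 < \<nu>" "\<nu> < 1" "\<beta> > 0" "Re y < 0" "\<tau> \<noteq> 0"
  shows "(\<lambda>n. y ^ n / fact n * of_real (Gamma (\<nu> * real n + \<beta>)) * (- (\<i> * of_real \<tau>)) powr (- of_real (\<nu> * real n + \<beta>))) sums
      (\<integral>r. of_real (r powr (\<beta> - 1)) * exp (\<i> * of_real \<tau> * of_real r) * exp (y * of_real (r powr \<nu>)) \<partial>lborel_pos)"
proof -
  define s where "s = (\<lambda>k. of_real (1 / real (Suc k)) - \<i> * of_real \<tau>)"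
  define s0 where "s0 = - (\<i> * of_real \<tau>)"
  have s0: "Im s0 \<noteq> 0" "cmod s0 = \<bar>\<tau>\<bar>" using assms by (auto simp: s0_def norm_mult)
  have sRe: "Re (s k) > 0" for k by (simp add: s_def)
  have slim: "s \<longlonglongrightarrow> s0"
  proof -
    have "(\<lambda>k. of_real (1 / real (Suc k)) - \<i> * of_real \<tau>) \<longlonglongrightarrow> of_real 0 - \<i> * of_real \<tau>"
      by (intro tendsto_intros) (rule LIMSEQ_Suc, rule lim_1_over_n)
    then show ?thesis by (simp add: s_def s0_def)
  qed
  have sn: "cmod (s k) \<ge> \<bar>\<tau>\<bar>" for k
    using abs_Im_le_cmod[of "s k"] by (simp add: s_def)
  define a where "a = (\<lambda>n z. y ^ n / fact n * of_real (Gamma (\<nu> * real n + \<beta>)) * z powr (- of_real (\<nu> * real n + \<beta>)))"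
  define F where "F = (\<lambda>z r. of_real (r powr (\<beta> - 1)) * exp (- (z * of_real r)) * exp (y * of_real (r powr \<nu>)))"
  define B where "B = (\<lambda>n. cmod y ^ n / fact n * Gamma (\<nu> * real n + \<beta>) * \<bar>\<tau>\<bar> powr (- (\<nu> * real n + \<beta>)))"
  have pos: "\<nu> * real n + \<beta> > 0" for n using assms by (simp add: add_nonneg_pos)
  have bnd: "norm (a n z) \<le> B n" if "cmod z \<ge> \<bar>\<tau>\<bar>" for n z
  proof -
    have "z \<noteq> 0" using that assms by auto
    then have "cmod (z powr (- of_real (\<nu> * real n + \<beta>))) = cmod z powr (- (\<nu> * real n + \<beta>))"
      by (simp add: norm_powr_real_powr')
    also have "\<dots> \<le> \<bar>\<tau>\<bar> powr (- (\<nu> * real n + \<beta>))"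
      using that assms pos[of n] by (intro powr_mono2') auto
    finally show ?thesis
      unfolding a_def B_def norm_mult using pos[of n]
      by (intro mult_mono) (auto simp: norm_divide norm_power)
  qed
  have "summable (\<lambda>n. \<bar>\<tau>\<bar> powr (- \<beta>) * (\<bar>cmod y * \<bar>\<tau>\<bar> powr (- \<nu>)\<bar> ^ n / fact n * Gamma (\<nu> * real n + \<beta>)))"
    using assms by (intro summable_mult summable_Gamma_over_fact)
  then have Bs: "summable B"
    unfolding B_def using assms powr_minus_affine[of "\<bar>\<tau>\<bar>"] by (simp add: abs_mult power_mult_distrib ac_simps)
  have T: "summable (\<lambda>n. norm (a n s0)) \<and> ((\<lambda>k. \<Sum>n. a n (s k)) \<longlonglongrightarrow> (\<Sum>n. a n s0))"
  proof -
    \<comment> \<open>The limit point has nonzero imaginary part, hence lies off the branch cut of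
      the complex power.\<close>
    have "((\<lambda>k. a n (s k)) \<longlonglongrightarrow> a n s0)" for n
      unfolding a_def using s0(1) slim
      by (intro tendsto_intros) (auto simp: complex_nonpos_Reals_iff)
    moreover have "eventually (\<lambda>(n,k). norm (a n (s k)) \<le> B n) (at_top \<times>\<^sub>F sequentially)"
      using bnd sn by (intro always_eventually) auto
    ultimately show ?thesis
      using tannerys_theorem[OF _ _ Bs, of "\<lambda>n k. a n (s k)" "\<lambda>n. a n s0" sequentially] by auto
  qed
  have "(\<lambda>k. integral\<^sup>L lborel_pos (F (s k))) \<longlonglongrightarrow> integral\<^sup>L lborel_pos (F s0)"
  proof (rule integral_dominated_convergence)
    show "integrable lborel_pos (\<lambda>r. r powr (\<beta> - 1) * exp (- ((- Re y) * r powr \<nu>)))"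
      using assms by (intro integrable_exp_powr) auto
    show "F s0 \<in> borel_measurable lborel_pos" "F (s k) \<in> borel_measurable lborel_pos" for k
      unfolding F_def by measurable
    show "AE r in lborel_pos. (\<lambda>k. F (s k) r) \<longlonglongrightarrow> F s0 r"
      unfolding F_def by (intro AE_I2 tendsto_intros slim)
    show "AE r in lborel_pos. norm (F (s k) r) \<le> r powr (\<beta> - 1) * exp (- ((- Re y) * r powr \<nu>))" for k
    proof (rule AE_I2)
      fix r assume "r \<in> space lborel_pos"
      then have "exp (- (Re (s k) * r)) \<le> 1" using sRe[of k] by simp
      then show "norm (F (s k) r) \<le> r powr (\<beta> - 1) * exp (- ((- Re y) * r powr \<nu>))"
        unfolding F_def by (auto simp: norm_mult mult_le_cancel_left mult.assoc intro!: mult_left_mono mult_left_le_one_le)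
    qed
  qed
  moreover have "integral\<^sup>L lborel_pos (F (s k)) = (\<Sum>n. a n (s k))" for k
    using exp_powr_transform(2)[OF assms(1-3) sRe, of y k] unfolding a_def F_def sums_iff by simp
  ultimately have "(\<Sum>n. a n s0) = integral\<^sup>L lborel_pos (F s0)"
    using T LIMSEQ_unique by auto
  then have "(\<lambda>n. a n s0) sums integral\<^sup>L lborel_pos (F s0)"
    using T summable_norm_cancel by (auto simp: sums_iff)
  then show ?thesis unfolding a_def F_def s0_def by simp
qed

section \<open>Fourier representation of the Wright function\<close>

lemma ii_powr:
  assumes "t > 0"
  shows "(\<i> * of_real t) powr (of_real w) = of_real (t powr w) * cis (w * pi / 2)"
    and "(- (\<i> * of_real t)) powr (of_real w) = of_real (t powr w) * cis (- (w * pi / 2))"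
proof -
  have t: "complex_of_real t powr of_real w = of_real (t powr w)"
    using assms powr_of_real[of t w] by simp
  have 1: "\<i> powr of_real w = cis (w * pi / 2)" "(- \<i>) powr of_real w = cis (- (w * pi / 2))"
    by (auto simp: powr_def cis_conv_exp algebra_simps)
  have "(of_real t * \<i>) powr of_real w = of_real t powr of_real w * \<i> powr of_real w"
    "(of_real t * (- \<i>)) powr of_real w = of_real t powr of_real w * (- \<i>) powr of_real w"
    using assms by (intro powr_times_real_left; auto)+
  then show "(\<i> * of_real t) powr (of_real w) = of_real (t powr w) * cis (w * pi / 2)"
    "(- (\<i> * of_real t)) powr (of_real w) = of_real (t powr w) * cis (- (w * pi / 2))"
    using 1 t by (simp_all add: mult.commute)
qed

lemma rGamma_reflection_real: "rGamma (1 - z) = Gamma z * sin (pi * z) / pi" if "z > 0" for z :: real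
proof -
  have "rGamma (complex_of_real z) * rGamma (1 - complex_of_real z) = sin (of_real pi * of_real z) / of_real pi"
    by (rule rGamma_reflection_complex)
  moreover have "rGamma (complex_of_real z) * rGamma (1 - complex_of_real z) = of_real (rGamma z * rGamma (1 - z))"
    by (simp flip: rGamma_complex_of_real)
  moreover have "sin (of_real pi * of_real z) / complex_of_real pi = of_real (sin (pi * z) / pi)"
    by (simp flip: sin_of_real)
  ultimately have "rGamma z * rGamma (1 - z) = sin (pi * z) / pi"
    by (metis of_real_eq_iff)
  moreover have "rGamma z = inverse (Gamma z)" by (simp add: rGamma_inverse_Gamma)
  ultimately show ?thesis using Gamma_real_pos[OF that] by (simp add: field_simps)
qed

text \<open>The transform runs along the positive imaginary axis, where \<open>(i r)\<^sup>\<nu> = cis (\<pi> \<nu> / 2) r\<^sup>\<nu>\<close>;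
  the factor \<open>cis (\<pi> (1 - b) / 2)\<close> in the lemmas below is \<open>i \<cdot> i\<^sup>-\<^sup>b\<close>.\<close>

definition levy_transform :: "real \<Rightarrow> real \<Rightarrow> real \<Rightarrow> real \<Rightarrow> complex" where
  "levy_transform \<nu> x b \<tau> =
     (\<integral>r. of_real (r powr (- b)) * exp (\<i> * of_real \<tau> * of_real r) *
       exp (- (of_real x * cis (pi * \<nu> / 2)) * of_real (r powr \<nu>)) \<partial>lborel_pos)"

text \<open>The angle \<open>pi * \<nu> / 2\<close> stays below a right angle, so the exponent has
  negative real part and the boundary expansion applies with \<open>\<beta> = 1 - b\<close>.\<close>

lemma levy_transform_sums:
  assumes "0 < \<nu>" "\<nu> < 1" "b < 1" "x > 0" "\<tau> \<noteq> 0"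
  shows "(\<lambda>n. cis (pi * (1 - b) / 2) * ((- (of_real x * cis (pi * \<nu> / 2))) ^ n / fact n * of_real (Gamma (\<nu> * real n + (1 - b))) * (- (\<i> * of_real \<tau>)) powr (- of_real (\<nu> * real n + (1 - b))))) sums
      (cis (pi * (1 - b) / 2) * levy_transform \<nu> x b \<tau>)"
proof -
  have "cos (pi * \<nu> / 2) > 0"
    using assms by (intro cos_gt_zero) auto
  then have "Re (- (of_real x * cis (pi * \<nu> / 2))) < 0"
    using assms by simp
  then show ?thesis
    using exp_powr_transform_boundary[of \<nu> "1 - b" "- (of_real x * cis (pi * \<nu> / 2))" \<tau>] assms
    unfolding levy_transform_def by (intro sums_mult) auto
qed

text \<open>For positive \<tau> the three phases of the \<open>n\<close>-th term add up to
  \<open>cis (pi * z)\<close> with \<open>z = \<nu> * n + (1 - b)\<close>. The imaginary part yields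
  \<open>Gamma z * sin (pi * z)\<close>, which reflection turns into
  \<open>pi * rGamma (1 - z)\<close>, the Wright coefficient.\<close>

lemma levy_transform_pos:
  assumes "0 < \<nu>" "\<nu> < 1" "b < 1" "x > 0" "\<tau> > 0"
  shows "Im (cis (pi * (1 - b) / 2) * levy_transform \<nu> x b \<tau>) = pi * \<tau> powr (b - 1) * wright (- (x * \<tau> powr (- \<nu>))) (- \<nu>) b"
proof -
  have "(\<lambda>n. pi * \<tau> powr (b - 1) * ((- (x * \<tau> powr (- \<nu>))) ^ n / fact n * rGamma (real n * (- \<nu>) + b))) sums
    Im (cis (pi * (1 - b) / 2) * levy_transform \<nu> x b \<tau>)"
  proof (rule sums_cong[THEN iffD1])
    show "(\<lambda>n. Im (cis (pi * (1 - b) / 2) * ((- (of_real x * cis (pi * \<nu> / 2))) ^ n / fact n * of_real (Gamma (\<nu> * real n + (1 - b))) * (- (\<i> * of_real \<tau>)) powr (- of_real (\<nu> * real n + (1 - b)))))) sums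
      Im (cis (pi * (1 - b) / 2) * levy_transform \<nu> x b \<tau>)"
      by (rule sums_Im[OF levy_transform_sums]) (use assms in auto)
    fix n
    define z where "z = \<nu> * real n + (1 - b)"
    have z: "z > 0" using assms by (simp add: z_def add_nonneg_pos)
    have 1: "(- (\<i> * of_real \<tau>)) powr (- of_real z) = of_real (\<tau> powr (- z)) * cis (pi * z / 2)"
      using ii_powr(2)[of \<tau> "- z"] assms by (simp add: mult.commute)
    have 2: "(- (of_real x * cis (pi * \<nu> / 2))) ^ n = of_real ((- x) ^ n) * cis (real n * (pi * \<nu> / 2))"
      unfolding minus_mult_left power_mult_distrib Complex.DeMoivre by simp
    have 3: "cis (pi * (1 - b) / 2) * cis (real n * (pi * \<nu> / 2)) * cis (pi * z / 2) = cis (pi * z)"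
      unfolding cis_mult by (rule arg_cong[of _ _ cis]) (simp add: z_def field_simps)
    have "cis (pi * (1 - b) / 2) * ((- (of_real x * cis (pi * \<nu> / 2))) ^ n / fact n * of_real (Gamma z) * (- (\<i> * of_real \<tau>)) powr (- of_real z))
      = of_real ((- x) ^ n / fact n * Gamma z * \<tau> powr (- z)) * (cis (pi * (1 - b) / 2) * cis (real n * (pi * \<nu> / 2)) * cis (pi * z / 2))"
      unfolding 1 2 by (simp add: ac_simps)
    then have eq: "cis (pi * (1 - b) / 2) * ((- (of_real x * cis (pi * \<nu> / 2))) ^ n / fact n * of_real (Gamma z) * (- (\<i> * of_real \<tau>)) powr (- of_real z))
      = of_real ((- x) ^ n / fact n * Gamma z * \<tau> powr (- z)) * cis (pi * z)"
      unfolding 3 .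
    have "Im (cis (pi * (1 - b) / 2) * ((- (of_real x * cis (pi * \<nu> / 2))) ^ n / fact n * of_real (Gamma z) * (- (\<i> * of_real \<tau>)) powr (- of_real z)))
      = (- x) ^ n / fact n * \<tau> powr (- z) * (Gamma z * sin (pi * z))"
      unfolding eq by (simp del: of_real_mult of_real_divide)
    also have "Gamma z * sin (pi * z) = pi * rGamma (1 - z)"
      using rGamma_reflection_real[OF z] by simp
    also have "1 - z = real n * (- \<nu>) + b" by (simp add: z_def)
    also have "\<tau> powr (- z) = \<tau> powr (b - 1) * (\<tau> powr (- \<nu>)) ^ n"
      using powr_minus_affine[of \<tau> \<nu> n "1 - b"] assms by (simp add: z_def)
    finally show "Im (cis (pi * (1 - b) / 2) * ((- (of_real x * cis (pi * \<nu> / 2))) ^ n / fact n * of_real (Gamma (\<nu> * real n + (1 - b))) * (- (\<i> * of_real \<tau>)) powr (- of_real (\<nu> * real n + (1 - b)))))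
      = pi * \<tau> powr (b - 1) * ((- (x * \<tau> powr (- \<nu>))) ^ n / fact n * rGamma (real n * (- \<nu>) + b))"
      unfolding z_def[symmetric] by (simp add: power_mult_distrib power_minus[of "x * _"] power_minus[of x])
  qed
  then have "(\<lambda>n. (- (x * \<tau> powr (- \<nu>))) ^ n / fact n * rGamma (real n * (- \<nu>) + b)) sums
    (Im (cis (pi * (1 - b) / 2) * levy_transform \<nu> x b \<tau>) / (pi * \<tau> powr (b - 1)))"
    using assms sums_mult_D[of "pi * \<tau> powr (b - 1)"] by auto
  then show ?thesis
    using assms unfolding wright_def sums_iff by (auto simp: field_simps)
qed

text \<open>Causality: a negative \<tau> reverses the phase of the complex power, the phases cancel,
  and every term of the series is real.\<close>

lemma levy_transform_neg:
  assumes "0 < \<nu>" "\<nu> < 1" "b < 1" "x > 0" "\<tau> < 0"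
  shows "Im (cis (pi * (1 - b) / 2) * levy_transform \<nu> x b \<tau>) = 0"
proof -
  have "Im (cis (pi * (1 - b) / 2) * ((- (of_real x * cis (pi * \<nu> / 2))) ^ n / fact n * of_real (Gamma (\<nu> * real n + (1 - b))) * (- (\<i> * of_real \<tau>)) powr (- of_real (\<nu> * real n + (1 - b))))) = 0" for n
  proof -
    define z where "z = \<nu> * real n + (1 - b)"
    have 1: "(- (\<i> * of_real \<tau>)) powr (- of_real z) = of_real ((- \<tau>) powr (- z)) * cis (- (pi * z / 2))"
      using ii_powr(1)[of "- \<tau>" "- z"] assms by (simp add: mult.commute)
    have 2: "(- (of_real x * cis (pi * \<nu> / 2))) ^ n = of_real ((- x) ^ n) * cis (real n * (pi * \<nu> / 2))"
      unfolding minus_mult_left power_mult_distrib Complex.DeMoivre by simp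
    have 3: "cis (pi * (1 - b) / 2) * cis (real n * (pi * \<nu> / 2)) * cis (- (pi * z / 2)) = cis 0"
      unfolding cis_mult by (rule arg_cong[of _ _ cis]) (simp add: z_def field_simps)
    have "cis (pi * (1 - b) / 2) * ((- (of_real x * cis (pi * \<nu> / 2))) ^ n / fact n * of_real (Gamma z) * (- (\<i> * of_real \<tau>)) powr (- of_real z))
      = of_real ((- x) ^ n / fact n * Gamma z * (- \<tau>) powr (- z)) * (cis (pi * (1 - b) / 2) * cis (real n * (pi * \<nu> / 2)) * cis (- (pi * z / 2)))"
      unfolding 1 2 by (simp add: ac_simps)
    then have eq: "cis (pi * (1 - b) / 2) * ((- (of_real x * cis (pi * \<nu> / 2))) ^ n / fact n * of_real (Gamma z) * (- (\<i> * of_real \<tau>)) powr (- of_real z))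
      = of_real ((- x) ^ n / fact n * Gamma z * (- \<tau>) powr (- z)) * cis 0"
      unfolding 3 .
    show ?thesis
      unfolding z_def[symmetric] eq by (simp del: of_real_mult of_real_divide)
  qed
  with sums_Im[OF levy_transform_sums[OF assms(1-4)], of \<tau>] assms show ?thesis
    by (simp add: sums_iff)
qed

text \<open>The one-sided Levy stable density with Laplace transform \<open>exp (-x s\<^sup>\<nu>)\<close>.\<close>

definition levy_density :: "real \<Rightarrow> real \<Rightarrow> real \<Rightarrow> real" where
  "levy_density \<nu> x \<tau> = Re (levy_transform \<nu> x 0 \<tau>) / pi"

text \<open>At \<open>b = 0\<close> the prefactor is \<open>cis (pi / 2)\<close>, the imaginary
  unit, so the imaginary part of the product is the real part of the transform.\<close>

lemma levy_density_neg:
  assumes "0 < \<nu>" "\<nu> < 1" "x > 0" "\<tau> < 0"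
  shows "levy_density \<nu> x \<tau> = 0"
  using levy_transform_neg[of \<nu> 0 x \<tau>] assms by (simp add: levy_density_def)

lemma levy_density_pos:
  assumes "0 < \<nu>" "\<nu> < 1" "x > 0" "\<tau> > 0"
  shows "levy_density \<nu> x \<tau> = wright (- (x * \<tau> powr (- \<nu>))) (- \<nu>) 0 / \<tau>"
  using levy_transform_pos[of \<nu> 0 x \<tau>] assms by (simp add: levy_density_def powr_minus field_simps)

lemma levy_transform_measurable [measurable]:
  "levy_transform \<nu> x b \<in> borel_measurable borel"
proof -
  interpret sigma_finite_measure lborel_pos by (rule sigma_finite_lborel_pos)
  have [measurable]: "(\<lambda>r. r) \<in> borel_measurable lborel_pos" by measurable
  show ?thesis unfolding levy_transform_def by measurable
qed

lemma levy_density_measurable [measurable]: "levy_density \<nu> x \<in> borel_measurable borel"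
  unfolding levy_density_def by measurable

lemma cos_half_pos: "0 < \<nu> \<Longrightarrow> \<nu> < 1 \<Longrightarrow> cos (pi * \<nu> / 2) > 0"
  by (intro cos_gt_zero) auto

lemma norm_exp_cis:
  "norm (exp (- (of_real x * cis \<theta>) * of_real r)) = exp (- ((x * cos \<theta>) * r))"
  by (simp add: norm_exp_eq_Re)

lemma norm_exp_ii: "norm (exp (\<i> * complex_of_real a * complex_of_real r)) = 1"
  by (simp add: norm_exp_eq_Re)

text \<open>The oscillating factor has modulus 1, so the bound is uniform in \<tau>.\<close>

lemma levy_transform_bounded:
  "norm (levy_transform \<nu> x 0 \<tau>) \<le> (\<integral>r. exp (- ((x * cos (pi * \<nu> / 2)) * r powr \<nu>)) \<partial>lborel_pos)"
proof -
  let ?f = "\<lambda>r. of_real (r powr (- 0)) * exp (\<i> * of_real \<tau> * of_real r) * exp (- (of_real x * cis (pi * \<nu> / 2)) * of_real (r powr \<nu>))"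
  have "norm (levy_transform \<nu> x 0 \<tau>) \<le> (\<integral>r. norm (?f r) \<partial>lborel_pos)"
    unfolding levy_transform_def by (rule integral_norm_bound)
  also have "\<dots> = (\<integral>r. exp (- ((x * cos (pi * \<nu> / 2)) * r powr \<nu>)) \<partial>lborel_pos)"
    by (intro Bochner_Integration.integral_cong refl) (simp only: norm_mult norm_exp_cis norm_exp_ii, simp)
  finally show ?thesis .
qed

section \<open>Abel integrals of the stable density\<close>

lemma levy_density_bounded:
  obtains C where "\<And>\<tau>. \<bar>levy_density \<nu> x \<tau>\<bar> \<le> C"
proof
  fix \<tau>
  have "\<bar>levy_density \<nu> x \<tau>\<bar> \<le> norm (levy_transform \<nu> x 0 \<tau>) / pi"
    using abs_Re_le_cmod by (simp add: levy_density_def divide_right_mono)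
  also have "\<dots> \<le> (\<integral>r. exp (- ((x * cos (pi * \<nu> / 2)) * r powr \<nu>)) \<partial>lborel_pos) / pi"
    by (intro divide_right_mono levy_transform_bounded) simp
  finally show "\<bar>levy_density \<nu> x \<tau>\<bar> \<le> (\<integral>r. exp (- ((x * cos (pi * \<nu> / 2)) * r powr \<nu>)) \<partial>lborel_pos) / pi" .
qed

text \<open>After exchanging the integrals, the one over \<open>u\<close> is a complex Gamma
  integral at \<open>\<epsilon> + i r\<close>. Absolute integrability holds because the norm of the
  integrand is a product of a function of \<open>u\<close> and a function of
  \<open>r\<close>.\<close>

lemma levy_transform_fubini:
  assumes "0 < \<nu>" "\<nu> < 1" "0 < b" "x > 0" "\<epsilon> > 0"
  shows "(\<integral>u. of_real (u powr (b - 1) * exp (- (\<epsilon> * u))) * levy_transform \<nu> x 0 (t - u) \<partial>lborel_pos) =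
    (\<integral>r. of_real (Gamma b) * (of_real \<epsilon> + \<i> * of_real r) powr (- of_real b) * (exp (\<i> * of_real t * of_real r) *
       exp (- (of_real x * cis (pi * \<nu> / 2)) * of_real (r powr \<nu>))) \<partial>lborel_pos)"
proof -
  interpret L: sigma_finite_measure lborel_pos by (rule sigma_finite_lborel_pos)
  interpret pair_sigma_finite lborel_pos lborel_pos by standard
  have [measurable]: "(\<lambda>r. r) \<in> borel_measurable lborel_pos" by measurable
  let ?E = "\<lambda>r. exp (- (of_real x * cis (pi * \<nu> / 2)) * complex_of_real (r powr \<nu>))"
  let ?e = "\<lambda>r. exp (- ((x * cos (pi * \<nu> / 2)) * r powr \<nu>))"
  let ?k = "\<lambda>u. u powr (b - 1) * exp (- (\<epsilon> * u))"
  define f where "f = (\<lambda>u r. complex_of_real (?k u) * (exp (\<i> * of_real (t - u) * of_real r) * ?E r))"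
  have nf: "norm (f u r) = ?k u * ?e r" for u r
    unfolding f_def norm_mult norm_exp_cis norm_exp_ii by (simp add: norm_mult)
  have ie: "integrable lborel_pos ?e"
  proof -
    have "integrable lborel_pos (\<lambda>r. r powr (1 - 1) * ?e r)"
      using assms cos_half_pos[of \<nu>] by (intro integrable_exp_powr) auto
    then show ?thesis
      by (rule Bochner_Integration.integrable_cong[THEN iffD1, rotated 2]) auto
  qed
  have ik: "integrable lborel_pos ?k"
    using has_bochner_integral_Gamma[of b \<epsilon>] assms by (simp add: has_bochner_integral_iff)
  have int: "integrable (lborel_pos \<Otimes>\<^sub>M lborel_pos) (\<lambda>(u, r). f u r)"
  proof (rule Fubini_integrable)
    show "(\<lambda>(u, r). f u r) \<in> borel_measurable (lborel_pos \<Otimes>\<^sub>M lborel_pos)"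
      unfolding f_def by measurable
    show "integrable lborel_pos (\<lambda>u. \<integral>r. norm (case (u, r) of (u, r) \<Rightarrow> f u r) \<partial>lborel_pos)"
      using ik by (simp add: nf)
    have "integrable lborel_pos (f u)" for u
    proof (rule Bochner_Integration.integrable_bound)
      show "integrable lborel_pos (\<lambda>r. ?k u * ?e r)" using ie by simp
      show "f u \<in> borel_measurable lborel_pos" unfolding f_def by measurable
    qed (simp add: nf)
    then show "AE u in lborel_pos. integrable lborel_pos (\<lambda>r. case (u, r) of (u, r) \<Rightarrow> f u r)"
      by simp
  qed
  have 1: "of_real (?k u) * levy_transform \<nu> x 0 (t - u) = (\<integral>r. f u r \<partial>lborel_pos)" for u
  proof -
    have "levy_transform \<nu> x 0 (t - u) = (\<integral>r. exp (\<i> * of_real (t - u) * of_real r) * ?E r \<partial>lborel_pos)"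
      unfolding levy_transform_def by (intro Bochner_Integration.integral_cong) auto
    then show ?thesis unfolding f_def by (simp only: integral_mult_right_zero)
  qed
  have 2: "(\<integral>u. f u r \<partial>lborel_pos) = of_real (Gamma b) * (of_real \<epsilon> + \<i> * of_real r) powr (- of_real b) * (exp (\<i> * of_real t * of_real r) * ?E r)" for r
  proof -
    have "f u r = of_real (u powr (b - 1)) * exp (- ((of_real \<epsilon> + \<i> * of_real r) * of_real u)) * (exp (\<i> * of_real t * of_real r) * ?E r)" for u
    proof -
      have "complex_of_real (exp (- (\<epsilon> * u))) * exp (\<i> * of_real (t - u) * of_real r)
        = exp (- ((of_real \<epsilon> + \<i> * of_real r) * of_real u)) * exp (\<i> * of_real t * of_real r)"
        by (simp add: algebra_simps flip: exp_of_real exp_add)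
      then show ?thesis unfolding f_def of_real_mult by (metis (no_types, lifting) mult.assoc)
    qed
    then show ?thesis
      using has_bochner_integral_Gamma_complex[of b "of_real \<epsilon> + \<i> * of_real r"] assms
      by (simp add: has_bochner_integral_iff)
  qed
  show ?thesis
    unfolding 1 using Fubini_integral[OF int] by (simp add: 2)
qed

text \<open>Take real parts in \<open>levy_transform_fubini\<close> and let \<epsilon> tend to 0. On
  the right the power of \<open>i r\<close> with exponent \<open>- b\<close> contributes the weight
  \<open>r powr (- b)\<close>, which changes the transform of parameter 0 into that of parameter
  \<open>b\<close>, hence into a Wright function.\<close>

lemma levy_density_fractional_integral:
  assumes "0 < \<nu>" "\<nu> < 1" "0 < b" "b < 1" "x > 0" "t > 0"
  shows "has_bochner_integral lborel_pos (\<lambda>u. u powr (b - 1) * levy_density \<nu> x (t - u))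
     (Gamma b * t powr (b - 1) * wright (- (x * t powr (- \<nu>))) (- \<nu>) b)"
proof -
  let ?E = "\<lambda>r. exp (- (of_real x * cis (pi * \<nu> / 2)) * complex_of_real (r powr \<nu>))"
  let ?e = "\<lambda>r. exp (- ((x * cos (pi * \<nu> / 2)) * r powr \<nu>))"
  obtain C where C: "\<And>\<tau>. \<bar>levy_density \<nu> x \<tau>\<bar> \<le> C"
    using levy_density_bounded by blast
  then have C0: "C \<ge> 0" by (meson abs_ge_zero order_trans)
  \<comment> \<open>The weight \<open>exp (- \<epsilon> u)\<close> makes Fubini applicable on the whole half-line \<open>u > 0\<close>; the range \<open>u > t\<close>
    contributes nothing since the density vanishes at negative times.\<close>
  define \<epsilon> where "\<epsilon> = (\<lambda>k. 1 / real (Suc k))"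
  have \<epsilon>: "\<epsilon> k > 0" for k by (simp add: \<epsilon>_def)
  have \<epsilon>lim: "\<epsilon> \<longlonglongrightarrow> 0" unfolding \<epsilon>_def by (rule LIMSEQ_Suc, rule lim_1_over_n)
  define g where "g = (\<lambda>u. u powr (b - 1) * levy_density \<nu> x (t - u))"
  \<comment> \<open>Dominates \<open>g\<close> and its damped versions: integrable at 0 since
    \<open>b > 0\<close>, cut off at \<open>t\<close> by causality.\<close>
  define D where "D = (\<lambda>u. if u \<le> t then u powr (b - 1) * C else 0)"
  have gD: "\<bar>g u\<bar> \<le> D u" for u
    using C[of "t - u"] levy_density_neg[of \<nu> x "t - u"] assms
    by (auto simp: g_def D_def abs_mult intro!: mult_left_mono)
  have iD: "integrable lborel_pos D"
  proof -
    have "((\<lambda>r. r powr (b - 1) * C) has_integral (t powr (b - 1 + 1) / (b - 1 + 1) * C)) {0..t}"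
      using assms by (intro has_integral_mult_left has_integral_powr_from_0) auto
    then have "((\<lambda>r. r powr (b - 1) * C) has_integral (t powr (b - 1 + 1) / (b - 1 + 1) * C)) {0<..t}"
      by (subst has_integral_spike_set_eq[of _ "{0..t}"]) (auto intro: negligible_subset[of "{0}"])
    then have "((\<lambda>r. if r \<in> {0<..t} then r powr (b - 1) * C else 0) has_integral (t powr (b - 1 + 1) / (b - 1 + 1) * C)) {0<..}"
      by (subst has_integral_restrict) auto
    then have "(D has_integral (t powr (b - 1 + 1) / (b - 1 + 1) * C)) {0<..}"
      by (rule has_integral_eq[rotated]) (auto simp: D_def)
    from has_bochner_integral_lborel_pos_nonneg[OF _ _ this] C0 show ?thesis
      by (auto simp: D_def has_bochner_integral_iff)
  qed
  have gm [measurable]: "g \<in> borel_measurable borel" unfolding g_def by measurable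
  have ig: "integrable lborel_pos g"
    by (rule Bochner_Integration.integrable_bound[OF iD]) (auto intro: order_trans[OF gD abs_ge_self])
  have lim1: "(\<lambda>k. \<integral>u. exp (- (\<epsilon> k * u)) * g u \<partial>lborel_pos) \<longlonglongrightarrow> (\<integral>u. exp (- (0 * u)) * g u \<partial>lborel_pos)"
  proof (rule integral_dominated_convergence)
    show "integrable lborel_pos D" by fact
    show "AE u in lborel_pos. (\<lambda>k. exp (- (\<epsilon> k * u)) * g u) \<longlonglongrightarrow> exp (- (0 * u)) * g u"
      by (intro AE_I2 tendsto_intros \<epsilon>lim)
    show "AE u in lborel_pos. norm (exp (- (\<epsilon> k * u)) * g u) \<le> D u" for k
    proof (rule AE_I2)
      fix u assume "u \<in> space lborel_pos"
      then have "exp (- (\<epsilon> k * u)) \<le> 1" using \<epsilon>[of k] by simp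
      then have "norm (exp (- (\<epsilon> k * u)) * g u) \<le> 1 * \<bar>g u\<bar>"
        unfolding norm_mult by (intro mult_mono) auto
      then show "norm (exp (- (\<epsilon> k * u)) * g u) \<le> D u" using gD[of u] by simp
    qed
  qed measurable
  define h where "h = (\<lambda>z r. of_real (Gamma b) * (of_real z + \<i> * of_real r) powr (- of_real b) * (exp (\<i> * of_real t * of_real r) * ?E r))"
  have lim2: "(\<lambda>k. \<integral>r. h (\<epsilon> k) r \<partial>lborel_pos) \<longlonglongrightarrow> (\<integral>r. h 0 r \<partial>lborel_pos)"
  proof (rule integral_dominated_convergence)
    \<comment> \<open>The modulus of \<open>\<epsilon> + i r\<close> is at least \<open>r\<close>,
      which gives a majorant free of \<epsilon>; it is integrable at 0 because
      \<open>b < 1\<close>.\<close>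
    have "integrable lborel_pos (\<lambda>r. Gamma b * (r powr ((1 - b) - 1) * ?e r))"
      using assms cos_half_pos[of \<nu>] by (intro integrable_mult_right integrable_exp_powr) auto
    then show "integrable lborel_pos (\<lambda>r. Gamma b * (r powr (- b) * ?e r))" by simp
    show "h 0 \<in> borel_measurable lborel_pos" "h (\<epsilon> k) \<in> borel_measurable lborel_pos" for k
      unfolding h_def by measurable
    show "AE r in lborel_pos. (\<lambda>k. h (\<epsilon> k) r) \<longlonglongrightarrow> h 0 r"
      unfolding h_def by (intro AE_I2 tendsto_intros \<epsilon>lim) (auto simp: complex_nonpos_Reals_iff)
    show "AE r in lborel_pos. norm (h (\<epsilon> k) r) \<le> Gamma b * (r powr (- b) * ?e r)" for k
    proof (rule AE_I2)
      fix r assume "r \<in> space lborel_pos"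
      then have r: "r > 0" by simp
      have "cmod (of_real (\<epsilon> k) + \<i> * of_real r) \<ge> r"
        using abs_Im_le_cmod[of "of_real (\<epsilon> k) + \<i> * of_real r"] by simp
      then have "cmod ((of_real (\<epsilon> k) + \<i> * of_real r) powr (- of_real b)) \<le> r powr (- b)"
        using r assms by (simp add: norm_powr_real_powr' powr_mono2')
      moreover have "Gamma b > 0" using assms by (simp add: Gamma_real_pos)
      ultimately show "norm (h (\<epsilon> k) r) \<le> Gamma b * (r powr (- b) * ?e r)"
        unfolding h_def norm_mult norm_exp_cis norm_exp_ii
        by (simp add: mult.assoc mult_left_mono mult_right_mono)
    qed
  qed
  have eq: "(\<integral>u. exp (- (\<epsilon> k * u)) * g u \<partial>lborel_pos) = Re (\<integral>r. h (\<epsilon> k) r \<partial>lborel_pos) / pi" for k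
  proof -
    have "Re (\<integral>r. h (\<epsilon> k) r \<partial>lborel_pos) = Re (\<integral>u. of_real (u powr (b - 1) * exp (- (\<epsilon> k * u))) * levy_transform \<nu> x 0 (t - u) \<partial>lborel_pos)"
      unfolding h_def using levy_transform_fubini[OF assms(1-3,5) \<epsilon>] by simp
    also have "\<dots> = (\<integral>u. Re (of_real (u powr (b - 1) * exp (- (\<epsilon> k * u))) * levy_transform \<nu> x 0 (t - u)) \<partial>lborel_pos)"
    proof (rule integral_Re[symmetric])
      let ?C = "\<integral>r. ?e r \<partial>lborel_pos"
      show "integrable lborel_pos (\<lambda>u. of_real (u powr (b - 1) * exp (- (\<epsilon> k * u))) * levy_transform \<nu> x 0 (t - u))"
      proof (rule Bochner_Integration.integrable_bound)
        show "integrable lborel_pos (\<lambda>u. u powr (b - 1) * exp (- (\<epsilon> k * u)) * ?C)"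
          using has_bochner_integral_Gamma[OF assms(3) \<epsilon>, of k] by (auto simp: has_bochner_integral_iff)
        show "AE u in lborel_pos. norm (of_real (u powr (b - 1) * exp (- (\<epsilon> k * u))) * levy_transform \<nu> x 0 (t - u))
          \<le> norm (u powr (b - 1) * exp (- (\<epsilon> k * u)) * ?C)"
        proof (rule AE_I2)
          fix u
          have "norm (levy_transform \<nu> x 0 (t - u)) \<le> \<bar>?C\<bar>"
            using levy_transform_bounded[of \<nu> x "t - u"] by linarith
          then show "norm (of_real (u powr (b - 1) * exp (- (\<epsilon> k * u))) * levy_transform \<nu> x 0 (t - u))
            \<le> norm (u powr (b - 1) * exp (- (\<epsilon> k * u)) * ?C)"
            by (simp add: norm_mult mult_left_mono)
        qed
      qed measurable
    qed
    also have "\<dots> = (\<integral>u. pi * (exp (- (\<epsilon> k * u)) * g u) \<partial>lborel_pos)"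
      by (intro Bochner_Integration.integral_cong refl) (simp add: g_def levy_density_def)
    finally show ?thesis by simp
  qed
  have "(\<integral>u. g u \<partial>lborel_pos) = Re (\<integral>r. h 0 r \<partial>lborel_pos) / pi"
    using lim1 tendsto_divide[OF tendsto_Re[OF lim2] tendsto_const[of pi]] unfolding eq
    by (auto dest: LIMSEQ_unique)
  also have "(\<integral>r. h 0 r \<partial>lborel_pos) = of_real (Gamma b) * cis (- (b * pi / 2)) * levy_transform \<nu> x b t"
  proof -
    have "h 0 r = (of_real (Gamma b) * cis (- (b * pi / 2))) * (of_real (r powr (- b)) * exp (\<i> * of_real t * of_real r) * ?E r)"
      if "r \<in> space lborel_pos" for r
      using ii_powr(1)[of r "- b"] that by (simp add: h_def)
    then have "(\<integral>r. h 0 r \<partial>lborel_pos) = (\<integral>r. (of_real (Gamma b) * cis (- (b * pi / 2))) * (of_real (r powr (- b)) * exp (\<i> * of_real t * of_real r) * ?E r) \<partial>lborel_pos)"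
      by (intro Bochner_Integration.integral_cong) auto
    then show ?thesis unfolding levy_transform_def by (simp only: integral_mult_right_zero)
  qed
  \<comment> \<open>The constant \<open>cis (- (b * pi / 2))\<close> lacks a factor i compared with
    the prefactor in \<open>levy_transform_pos\<close>; supplying it turns the real part into an
    imaginary part.\<close>
  also have "Re (of_real (Gamma b) * cis (- (b * pi / 2)) * levy_transform \<nu> x b t) = Gamma b * Im (cis (pi * (1 - b) / 2) * levy_transform \<nu> x b t)"
  proof -
    have "cis (pi * (1 - b) / 2) = \<i> * cis (- (b * pi / 2))"
      by (simp add: cis_mult algebra_simps diff_divide_distrib flip: cis_pi_half)
    then show ?thesis by (simp add: mult.assoc)
  qed
  also have "\<dots> / pi = Gamma b * t powr (b - 1) * wright (- (x * t powr (- \<nu>))) (- \<nu>) b"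
    using levy_transform_pos[of \<nu> b x t] assms by simp
  finally show ?thesis using ig by (simp add: has_bochner_integral_iff g_def)
qed

section \<open>Calculus of the Wright function\<close>

text \<open>All but finitely many of the numbers \<open>z = \<nu> * n + (1 - b)\<close> are
  positive; for these, reflection bounds \<open>\<bar>rGamma (1 - z)\<bar>\<close> by
  \<open>Gamma z / pi\<close>, and the Gamma series dominates.\<close>

lemma wright_coeff_abs_summable:
  assumes "0 < \<nu>" "\<nu> < 1"
  shows "summable (\<lambda>n. \<bar>rGamma (real n * (- \<nu>) + b) / fact n\<bar> * \<bar>y\<bar> ^ n)"
proof -
  have "eventually (\<lambda>n. \<nu> * real n + (1 - b) > 0) sequentially"
    using assms by real_asymp
  then obtain N where N: "\<And>n. n \<ge> N \<Longrightarrow> \<nu> * real n + (1 - b) > 0"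
    by (auto simp: eventually_sequentially)
  show ?thesis
  proof (rule summable_comparison_test')
    show "summable (\<lambda>n. \<bar>y\<bar> ^ n / fact n * Gamma (\<nu> * real n + (1 - b)) * (1 / pi))"
      using assms by (intro summable_mult2 summable_Gamma_over_fact)
    fix n assume n: "n \<ge> N"
    define z where "z = \<nu> * real n + (1 - b)"
    have z: "z > 0" using N[OF n] by (simp add: z_def)
    have eq: "real n * (- \<nu>) + b = 1 - z" by (simp add: z_def)
    have "\<bar>rGamma (1 - z)\<bar> \<le> Gamma z / pi"
      unfolding rGamma_reflection_real[OF z] using Gamma_real_pos[OF z]
      by (simp add: abs_mult divide_right_mono mult_left_le)
    then show "norm (\<bar>rGamma (real n * (- \<nu>) + b) / fact n\<bar> * \<bar>y\<bar> ^ n) \<le> \<bar>y\<bar> ^ n / fact n * Gamma (\<nu> * real n + (1 - b)) * (1 / pi)"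
      unfolding z_def[symmetric] eq
      using mult_right_mono[of "\<bar>rGamma (1 - z)\<bar>" "Gamma z / pi" "\<bar>y\<bar> ^ n / fact n"] by (simp add: field_simps)
  qed
qed

text \<open>Stated over a general field: real arguments serve differentiation, complex ones the
  identity theorem.\<close>

lemma wright_coeff_summable:
  fixes y :: "'a :: {real_normed_field, banach}"
  assumes "0 < \<nu>" "\<nu> < 1"
  shows "summable (\<lambda>n. of_real (rGamma (real n * (- \<nu>) + b) / fact n) * y ^ n)"
proof (rule summable_norm_cancel)
  show "summable (\<lambda>n. norm (of_real (rGamma (real n * (- \<nu>) + b) / fact n) * y ^ n))"
    using wright_coeff_abs_summable[OF assms, of b "norm y"]
    by (simp add: norm_mult norm_power norm_divide)
qed

lemma wright_altdef: "wright z a b = (\<Sum>n. rGamma (real n * a + b) / fact n * z ^ n)"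
  by (simp add: wright_def mult_ac)

text \<open>The index shift of termwise differentiation moves the Gamma argument by
  \<open>- \<nu>\<close> and cancels one factor of the factorial, so each derivative lowers the
  parameter by \<nu>.\<close>

lemma wright_has_derivative:
  assumes "0 < \<nu>" "\<nu> < 1"
  shows "((\<lambda>z. wright z (- \<nu>) b) has_real_derivative wright z (- \<nu>) (b - \<nu>)) (at z)"
proof -
  have "((\<lambda>z. \<Sum>n. rGamma (real n * (- \<nu>) + b) / fact n * z ^ n) has_real_derivative
     (\<Sum>n. diffs (\<lambda>n. rGamma (real n * (- \<nu>) + b) / fact n) n * z ^ n)) (at z)"
    by (rule termdiffs_strong_converges_everywhere) (use wright_coeff_summable[OF assms, where 'a = real] in simp)
  moreover have "diffs (\<lambda>n. rGamma (real n * (- \<nu>) + b) / fact n) n = rGamma (real n * (- \<nu>) + (b - \<nu>)) / fact n" for n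
  proof -
    have eq: "real (Suc n) * (- \<nu>) + b = real n * (- \<nu>) + (b - \<nu>)" by (simp add: algebra_simps)
    show ?thesis unfolding diffs_def eq by (simp del: of_nat_Suc)
  qed
  ultimately show ?thesis unfolding wright_altdef by simp
qed

lemma wright_0 [simp]: "wright 0 a b = rGamma b"
  using sums_unique[OF powser_sums_zero[of "\<lambda>n. rGamma (real n * a + b) / fact n"]]
  by (simp add: wright_altdef)

text \<open>The constant term is \<open>rGamma 0 = 0\<close>. In the others the functional equation
  raises the Gamma argument by 1 and releases a factor \<open>- \<nu> * (n + 1)\<close>, whose
  \<open>n + 1\<close> cancels against the factorial. This ties the stable density to the Mainardi
  function.\<close>

lemma wright_at_zero_param:
  assumes "0 < \<nu>" "\<nu> < 1"
  shows "wright z (- \<nu>) 0 = - \<nu> * z * wright z (- \<nu>) (1 - \<nu>)"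
proof -
  let ?a = "\<lambda>n. rGamma (real n * (- \<nu>) + 0) / fact n * z ^ n"
  have "summable ?a"
    using wright_coeff_summable[OF assms, of 0 z] by simp
  then have "(\<Sum>n. ?a (Suc n)) = wright z (- \<nu>) 0 - ?a 0"
    unfolding wright_altdef by (rule suminf_split_head)
  then have "wright z (- \<nu>) 0 = (\<Sum>n. ?a (Suc n))" by simp
  also have "\<dots> = (\<Sum>n. - \<nu> * z * (rGamma (real n * (- \<nu>) + (1 - \<nu>)) / fact n * z ^ n))"
  proof (rule suminf_cong)
    fix n
    have "rGamma (real (Suc n) * (- \<nu>)) = (real (Suc n) * (- \<nu>)) * rGamma (real (Suc n) * (- \<nu>) + 1)"
      by (rule rGamma_plus1[symmetric])
    also have "real (Suc n) * (- \<nu>) + 1 = real n * (- \<nu>) + (1 - \<nu>)" by (simp add: algebra_simps)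
    finally have eq: "rGamma (real (Suc n) * (- \<nu>)) = (real (Suc n) * (- \<nu>)) * rGamma (real n * (- \<nu>) + (1 - \<nu>))" .
    show "?a (Suc n) = - \<nu> * z * (rGamma (real n * (- \<nu>) + (1 - \<nu>)) / fact n * z ^ n)"
      unfolding add_0_right eq by (simp add: field_simps del: of_nat_Suc)
  qed
  also have "\<dots> = - \<nu> * z * wright z (- \<nu>) (1 - \<nu>)"
    unfolding wright_altdef using wright_coeff_summable[OF assms, of "1 - \<nu>" z] by (intro suminf_mult) simp
  finally show ?thesis .
qed

section \<open>The similarity variable in time\<close>

lemma wright_similarity_derivative:
  assumes "0 < \<nu>" "\<nu> < 1" "x > 0" "\<tau> > 0"
  shows "((\<lambda>\<tau>. wright (- (x * \<tau> powr (- \<nu>))) (- \<nu>) 1) has_real_derivative levy_density \<nu> x \<tau>) (at \<tau>)"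
proof -
  let ?z = "- (x * \<tau> powr (- \<nu>))"
  have "((\<lambda>\<tau>. - (x * \<tau> powr (- \<nu>))) has_real_derivative - (x * (- \<nu> * \<tau> powr (- \<nu> - 1)))) (at \<tau>)"
    using assms by (auto intro!: derivative_eq_intros)
  from DERIV_chain2[OF wright_has_derivative this] assms
  have "((\<lambda>\<tau>. wright (- (x * \<tau> powr (- \<nu>))) (- \<nu>) 1) has_real_derivative
    wright ?z (- \<nu>) (1 - \<nu>) * - (x * (- \<nu> * \<tau> powr (- \<nu> - 1)))) (at \<tau>)" by blast
  \<comment> \<open>\<open>levy_density_pos\<close> has parameter 0 while the chain rule gives
    \<open>1 - \<nu>\<close>; \<open>wright_at_zero_param\<close> reconciles them.\<close>
  also have "wright ?z (- \<nu>) (1 - \<nu>) * - (x * (- \<nu> * \<tau> powr (- \<nu> - 1))) = levy_density \<nu> x \<tau>"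
    unfolding levy_density_pos[OF assms] wright_at_zero_param[OF assms(1,2)]
    using assms by (simp add: powr_diff)
  finally show ?thesis .
qed

text \<open>Reflect by \<open>u = t - \<tau>\<close>; causality cuts the half-line down to
  \<open>{0..t}\<close>.\<close>

lemma levy_density_abel_integral:
  assumes "0 < \<nu>" "\<nu> < 1" "0 < b" "b < 1" "x > 0" "t > 0"
  shows "((\<lambda>\<tau>. levy_density \<nu> x \<tau> / (t - \<tau>) powr (1 - b)) has_integral
    Gamma b * t powr (b - 1) * wright (- (x * t powr (- \<nu>))) (- \<nu>) b) {0..t}"
proof -
  let ?c = "Gamma b * t powr (b - 1) * wright (- (x * t powr (- \<nu>))) (- \<nu>) b"
  let ?h = "\<lambda>u. indicator {0<..} u *\<^sub>R (u powr (b - 1) * levy_density \<nu> x (t - u))"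
  have "has_bochner_integral lborel ?h ?c"
    using levy_density_fractional_integral[OF assms] unfolding lborel_pos_def
    by (auto simp: has_bochner_integral_iff integrable_restrict_space integral_restrict_space
      set_integrable_def set_lebesgue_integral_def)
  then have "has_bochner_integral lborel (\<lambda>\<tau>. ?h (t + (- 1) * \<tau>)) ?c"
    by (subst (asm) lborel_has_bochner_integral_real_affine_iff[where c = "-1" and t = t]) auto
  then have i: "integrable lborel (\<lambda>\<tau>. ?h (t + (- 1) * \<tau>))"
    and e: "integral\<^sup>L lborel (\<lambda>\<tau>. ?h (t + (- 1) * \<tau>)) = ?c"
    unfolding has_bochner_integral_iff by blast+
  have "((\<lambda>\<tau>. ?h (t + (- 1) * \<tau>)) has_integral ?c) UNIV"
    using has_integral_integral_lborel[OF i] unfolding e .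
  then have "((\<lambda>\<tau>. if \<tau> \<in> {0..t} then levy_density \<nu> x \<tau> / (t - \<tau>) powr (1 - b) else 0) has_integral ?c) UNIV"
  proof (rule has_integral_eq[rotated])
    fix \<tau>
    \<comment> \<open>At \<open>\<tau> = t\<close> both sides vanish: the indicator leaves out
      \<open>u = 0\<close>, and \<open>0 powr (1 - b) = 0\<close> makes the quotient 0.\<close>
    show "?h (t + (- 1) * \<tau>) = (if \<tau> \<in> {0..t} then levy_density \<nu> x \<tau> / (t - \<tau>) powr (1 - b) else 0)"
      using levy_density_neg[of \<nu> x \<tau>] assms
      by (cases "\<tau> < 0"; cases "\<tau> < t") (auto simp: indicator_def powr_diff field_simps)
  qed
  then show ?thesis by (subst (asm) has_integral_restrict_UNIV)
qed

lemma levy_density_integrable: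
  assumes "0 < \<nu>" "\<nu> < 1"
  shows "levy_density \<nu> x integrable_on {0..t}"
proof -
  obtain C where C: "\<And>\<tau>. \<bar>levy_density \<nu> x \<tau>\<bar> \<le> C"
    using levy_density_bounded by blast
  show ?thesis
  proof (rule measurable_bounded_by_integrable_imp_integrable)
    show "levy_density \<nu> x \<in> borel_measurable (lebesgue_on {0..t})"
      by (intro measurable_restrict_space1 measurable_completion) simp
    show "(\<lambda>_. C) integrable_on {0..t}" by (rule integrable_const_ivl)
  qed (use C in auto)
qed

lemma wright_similarity_integral:
  assumes "0 < \<nu>" "\<nu> < 1" "x > 0" "0 < s" "s \<le> t"
  shows "integral {0..t} (levy_density \<nu> x) - integral {0..s} (levy_density \<nu> x) =
    wright (- (x * t powr (- \<nu>))) (- \<nu>) 1 - wright (- (x * s powr (- \<nu>))) (- \<nu>) 1"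
proof -
  have "(levy_density \<nu> x has_integral wright (- (x * t powr (- \<nu>))) (- \<nu>) 1 - wright (- (x * s powr (- \<nu>))) (- \<nu>) 1) {s..t}"
    using assms wright_similarity_derivative[OF assms(1-3)]
    by (intro fundamental_theorem_of_calculus)
       (auto intro: has_field_derivative_at_within simp: has_real_derivative_iff_has_vector_derivative[symmetric])
  moreover have "integral {0..s} (levy_density \<nu> x) + integral {s..t} (levy_density \<nu> x) = integral {0..t} (levy_density \<nu> x)"
    using assms levy_density_integrable[OF assms(1,2)] by (intro Henstock_Kurzweil_Integration.integral_combine) auto
  ultimately show ?thesis by (simp add: integral_unique)
qed

text \<open>No asymptotics of the Wright series enter: for positive times the profile differs by a
  constant from the indefinite integral of a bounded density, which is continuous at 0.\<close>

lemma wright_similarity_limit: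
  assumes "0 < \<nu>" "\<nu> < 1" "x > 0"
  shows "((\<lambda>s. wright (- (x * s powr (- \<nu>))) (- \<nu>) 1) \<longlongrightarrow>
    wright (- x) (- \<nu>) 1 - integral {0..1} (levy_density \<nu> x)) (at_right 0)"
proof -
  have "continuous_on {0..1} (\<lambda>s. integral {0..s} (levy_density \<nu> x))"
    by (rule indefinite_integral_continuous_1) (rule levy_density_integrable[OF assms(1,2)])
  then have "((\<lambda>s. integral {0..s} (levy_density \<nu> x)) \<longlongrightarrow> integral {0..0} (levy_density \<nu> x)) (at_right 0)"
    using continuous_on_Icc_at_rightD by fastforce
  then have "((\<lambda>s. wright (- x) (- \<nu>) 1 - integral {0..1} (levy_density \<nu> x) + integral {0..s} (levy_density \<nu> x)) \<longlongrightarrow>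
    wright (- x) (- \<nu>) 1 - integral {0..1} (levy_density \<nu> x)) (at_right 0)"
    by (auto intro!: tendsto_eq_intros)
  moreover have "eventually (\<lambda>s. wright (- x) (- \<nu>) 1 - integral {0..1} (levy_density \<nu> x) + integral {0..s} (levy_density \<nu> x)
     = wright (- (x * s powr (- \<nu>))) (- \<nu>) 1) (at_right 0)"
  proof -
    have "eventually (\<lambda>s::real. s \<in> {0<..<1}) (at_right 0)"
      by (rule eventually_at_right_real) simp
    then show ?thesis
    proof eventually_elim
      case (elim s)
      then show ?case using wright_similarity_integral[OF assms, of s 1] by simp
    qed
  qed
  ultimately show ?thesis by (rule Lim_transform_eventually)
qed

lemma wright_limit_at_top:
  assumes "0 < \<nu>" "\<nu> < 1"
  obtains W where "((\<lambda>x. wright (- x) (- \<nu>) 1) \<longlongrightarrow> W) at_top"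
proof
  \<comment> \<open>At position 1 and time \<open>y powr (- 1 / \<nu>)\<close> the similarity
    variable is \<open>y\<close>, so the limit at time 0 becomes the limit at infinity.\<close>
  have "filterlim (\<lambda>y::real. y powr (- 1 / \<nu>)) (at_right 0) at_top"
    using assms by real_asymp
  from filterlim_compose[OF wright_similarity_limit[OF assms zero_less_one] this]
  have "((\<lambda>y. wright (- (1 * (y powr (- 1 / \<nu>)) powr (- \<nu>))) (- \<nu>) 1) \<longlongrightarrow>
    wright (- 1) (- \<nu>) 1 - integral {0..1} (levy_density \<nu> 1)) at_top" .
  moreover have "eventually (\<lambda>y. wright (- (1 * (y powr (- 1 / \<nu>)) powr (- \<nu>))) (- \<nu>) 1 = wright (- y) (- \<nu>) 1) at_top"
    using eventually_gt_at_top[of 0] by eventually_elim (use assms in \<open>simp add: powr_powr\<close>)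
  ultimately show "((\<lambda>y. wright (- y) (- \<nu>) 1) \<longlongrightarrow> wright (- 1) (- \<nu>) 1 - integral {0..1} (levy_density \<nu> 1)) at_top"
    by (rule Lim_transform_eventually)
qed

section \<open>Maximum principle and positivity\<close>

text \<open>The factor \<open>\<sigma>\<close> covers maxima (\<open>\<sigma> > 0\<close>) and minima (\<open>\<sigma> < 0\<close>) at once. The bound on the Abel integral
  comes from \<open>((1 - \<tau>)\<^sup>-\<^sup>2\<^sup>\<nu> \<psi>)' \<le> (1 - \<tau>)\<^sup>-\<^sup>2\<^sup>\<nu> \<psi>'\<close> for \<open>\<psi> \<le> 0\<close>.\<close>

lemma wright_second_derivative_sign_at_max:
  fixes \<sigma> :: real
  assumes "0 < \<nu>" "\<nu> < 1/2" "x > 0"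
    and lim: "((\<lambda>x. wright (- x) (- \<nu>) 1) \<longlongrightarrow> W) at_top"
    and gt: "\<sigma> * W < \<sigma> * wright (- x) (- \<nu>) 1"
    and max: "\<And>y. y \<ge> x \<Longrightarrow> \<sigma> * wright (- y) (- \<nu>) 1 \<le> \<sigma> * wright (- x) (- \<nu>) 1"
  shows "\<sigma> * wright (- x) (- \<nu>) (1 - 2 * \<nu>) > 0"
proof -
  define \<phi> where "\<phi> = (\<lambda>\<tau>. wright (- (x * \<tau> powr (- \<nu>))) (- \<nu>) 1)"
  define \<psi> where "\<psi> = (\<lambda>\<tau>. \<sigma> * \<phi> \<tau> - \<sigma> * \<phi> 1)"
  define P where "P = levy_density \<nu> x"
  define g where "g = (\<lambda>\<tau>. P \<tau> / (1 - \<tau>) powr (2 * \<nu>))"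
  have \<nu>: "0 < \<nu>" "\<nu> < 1" using assms by auto
  \<comment> \<open>The Abel integral with \<open>b = 1 - 2 * \<nu>\<close> at time 1, where the
    similarity variable equals \<open>x\<close>.\<close>
  have g_int: "(g has_integral Gamma (1 - 2 * \<nu>) * wright (- x) (- \<nu>) (1 - 2 * \<nu>)) {0..1}"
    using levy_density_abel_integral[OF \<nu>, of "1 - 2 * \<nu>" x 1] assms by (simp add: g_def P_def)
  have \<phi>1: "\<phi> 1 = wright (- x) (- \<nu>) 1" by (simp add: \<phi>_def)
  have d\<phi>: "(\<phi> has_real_derivative P \<tau>) (at \<tau>)" if "\<tau> > 0" for \<tau>
    unfolding \<phi>_def P_def using wright_similarity_derivative[OF \<nu> \<open>x > 0\<close> that] .
  have "filterlim (\<lambda>\<tau>. x * \<tau> powr (- \<nu>)) at_top (at_right 0)"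
    using assms by real_asymp
  from filterlim_compose[OF lim this] have \<phi>0: "(\<phi> \<longlongrightarrow> W) (at_right 0)"
    by (simp add: \<phi>_def)
  \<comment> \<open>Times up to 1 correspond to points
    \<open>x * \<tau> powr (- \<nu>) \<ge> x\<close>, where the assumption \<open>max\<close>
    applies.\<close>
  have \<psi>_le: "\<psi> \<tau> \<le> 0" if "0 < \<tau>" "\<tau> \<le> 1" for \<tau>
  proof -
    have "\<tau> powr (- \<nu>) \<ge> 1 powr (- \<nu>)" using that \<nu> by (intro powr_mono2') auto
    then have "x * \<tau> powr (- \<nu>) \<ge> x" using assms by simp
    from max[OF this] show ?thesis by (simp add: \<psi>_def \<phi>1) (simp add: \<phi>_def)
  qed
  \<comment> \<open>\<open>H\<close> extends
    \<open>(1 - \<tau>) powr (- (2 * \<nu>)) * \<psi> \<tau>\<close> continuously to 0 by means of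
    the limit \<open>W\<close>; \<open>h\<close> is its derivative inside, with \<open>h 0\<close>
    chosen so that \<open>h \<le> \<sigma> * g\<close> holds at 0 too.\<close>
  define H where "H = (\<lambda>\<tau>. if \<tau> = 0 then \<sigma> * W - \<sigma> * \<phi> 1 else (1 - \<tau>) powr (- (2 * \<nu>)) * \<psi> \<tau>)"
  define h where "h = (\<lambda>\<tau>. if \<tau> = 0 then \<sigma> * g 0 else \<sigma> * g \<tau> + 2 * \<nu> * (1 - \<tau>) powr (- (2 * \<nu>) - 1) * \<psi> \<tau>)"
  have dH: "(H has_real_derivative h \<tau>) (at \<tau>)" if "0 < \<tau>" "\<tau> < 1" for \<tau>
  proof (rule has_field_derivative_transform_within_open[where S = "{0<..}"])
    have "((\<lambda>\<tau>. (1 - \<tau>) powr (- (2 * \<nu>)) * \<psi> \<tau>) has_real_derivative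
      (1 - \<tau>) powr (- (2 * \<nu>)) * (\<sigma> * P \<tau>) + (- (2 * \<nu>) * (1 - \<tau>) powr (- (2 * \<nu>) - 1) * (- 1)) * \<psi> \<tau>) (at \<tau>)"
      unfolding \<psi>_def using that by (auto intro!: derivative_eq_intros d\<phi>)
    then show "((\<lambda>\<tau>. (1 - \<tau>) powr (- (2 * \<nu>)) * \<psi> \<tau>) has_real_derivative h \<tau>) (at \<tau>)"
      using that by (simp add: h_def g_def powr_minus_divide)
  qed (use that in \<open>auto simp: H_def\<close>)
  have ineq: "\<sigma> * integral {0..s} g \<ge> H s - H 0" if s: "0 < s" "s < 1" for s
  proof (rule has_integral_le)
    have "continuous_on {0..s} H"
    proof (rule continuous_on_IccI)
      have "((\<lambda>\<tau>. (1 - \<tau>) powr (- (2 * \<nu>)) * \<psi> \<tau>) \<longlongrightarrow> (1 - 0) powr (- (2 * \<nu>)) * (\<sigma> * W - \<sigma> * \<phi> 1)) (at_right 0)"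
        unfolding \<psi>_def by (intro tendsto_intros \<phi>0) auto
      moreover have "eventually (\<lambda>\<tau>. (1 - \<tau>) powr (- (2 * \<nu>)) * \<psi> \<tau> = H \<tau>) (at_right 0)"
        by (auto simp: H_def eventually_at_filter)
      ultimately show "(H \<longlongrightarrow> H 0) (at_right 0)"
        by (simp add: H_def[THEN fun_cong, of 0] Lim_transform_eventually)
      have "isCont H s" using dH[OF s] by (rule DERIV_isCont)
      then show "(H \<longlongrightarrow> H s) (at_left s)"
        by (simp add: isCont_def filterlim_at_split)
      show "\<And>x. 0 < x \<Longrightarrow> x < s \<Longrightarrow> H \<midarrow>x\<rightarrow> H x"
        using dH s DERIV_isCont by (force simp: isCont_def)
    qed (use s in auto)
    then show "(h has_integral (H s - H 0)) {0..s}"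
      using s dH by (intro fundamental_theorem_of_calculus_interior)
        (auto simp: has_real_derivative_iff_has_vector_derivative[symmetric])
    have "g integrable_on {0..s}"
      using g_int s by (auto intro: integrable_on_subinterval)
    then show "((\<lambda>\<tau>. \<sigma> * g \<tau>) has_integral \<sigma> * integral {0..s} g) {0..s}"
      by (intro has_integral_mult_right) (rule integrable_integral)
    fix \<tau> assume "\<tau> \<in> {0..s}"
    then show "h \<tau> \<le> \<sigma> * g \<tau>"
      using \<psi>_le[of \<tau>] s \<nu> by (auto simp: h_def mult_nonneg_nonpos)
  qed
  obtain C where C: "\<And>\<tau>. \<bar>P \<tau>\<bar> \<le> C"
    using levy_density_bounded unfolding P_def by blast
  \<comment> \<open>By the mean value theorem and the bounded density, \<psi> vanishes at least
    linearly at 1, which beats the singular factor since \<open>2 * \<nu> < 1\<close>.\<close>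
  have H1: "(H \<longlongrightarrow> 0) (at_left 1)"
  proof (rule Lim_null_comparison)
    show "((\<lambda>s. \<bar>\<sigma>\<bar> * C * (1 - s) powr (1 - 2 * \<nu>)) \<longlongrightarrow> 0) (at_left 1)"
      using assms by real_asymp
    have "eventually (\<lambda>s::real. s \<in> {0<..<1}) (at_left 1)"
      by (rule eventually_at_left_real) simp
    then show "eventually (\<lambda>s. norm (H s) \<le> \<bar>\<sigma>\<bar> * C * (1 - s) powr (1 - 2 * \<nu>)) (at_left 1)"
    proof eventually_elim
      case (elim s)
      then obtain z where z: "\<phi> 1 - \<phi> s = (1 - s) * P z"
        using MVT2[of s 1 \<phi> P] d\<phi> by auto
      have "norm (\<psi> s) = \<bar>\<sigma>\<bar> * \<bar>\<phi> 1 - \<phi> s\<bar>"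
        unfolding \<psi>_def by (simp add: abs_mult abs_minus_commute flip: right_diff_distrib)
      also have "\<dots> \<le> \<bar>\<sigma>\<bar> * ((1 - s) * C)"
        unfolding z abs_mult using elim C[of z] by (intro mult_left_mono) auto
      finally have "norm (H s) \<le> (1 - s) powr (- (2 * \<nu>)) * (\<bar>\<sigma>\<bar> * ((1 - s) * C))"
        using elim by (simp add: H_def abs_mult mult_left_mono)
      also have "\<dots> = \<bar>\<sigma>\<bar> * C * ((1 - s) powr (- (2 * \<nu>)) * (1 - s) powr 1)"
        using elim by simp
      also have "(1 - s) powr (- (2 * \<nu>)) * (1 - s) powr 1 = (1 - s) powr (1 - 2 * \<nu>)"
        by (simp only: powr_add[symmetric]) simp
      finally show ?case .
    qed
  qed
  have "continuous_on {0..1} (\<lambda>s. integral {0..s} g)"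
    by (rule indefinite_integral_continuous_1) (use g_int in auto)
  then have "((\<lambda>s. integral {0..s} g) \<longlongrightarrow> integral {0..1} g) (at_left 1)"
    by (rule continuous_on_Icc_at_leftD) simp
  then have L: "((\<lambda>s. \<sigma> * integral {0..s} g) \<longlongrightarrow> \<sigma> * integral {0..1} g) (at_left 1)"
    by (intro tendsto_intros)
  have R: "((\<lambda>s. H s - H 0) \<longlongrightarrow> 0 - H 0) (at_left 1)"
    by (intro tendsto_intros H1)
  \<comment> \<open>\<open>- H 0\<close> is \<open>\<sigma> * (\<phi> 1 - W)\<close>, positive by
    \<open>gt\<close>.\<close>
  have "0 - H 0 \<le> \<sigma> * integral {0..1} g"
  proof (rule tendsto_le[OF _ L R])
    have "eventually (\<lambda>s::real. s \<in> {0<..<1}) (at_left 1)"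
      by (rule eventually_at_left_real) simp
    then show "eventually (\<lambda>s. H s - H 0 \<le> \<sigma> * integral {0..s} g) (at_left 1)"
      by eventually_elim (use ineq in auto)
  qed simp
  also have "integral {0..1} g = Gamma (1 - 2 * \<nu>) * wright (- x) (- \<nu>) (1 - 2 * \<nu>)"
    using g_int by (rule integral_unique)
  finally have "0 < Gamma (1 - 2 * \<nu>) * (\<sigma> * wright (- x) (- \<nu>) (1 - 2 * \<nu>))"
    using gt by (simp add: H_def \<phi>1 mult_ac)
  moreover have "Gamma (1 - 2 * \<nu>) > 0" using assms by (intro Gamma_real_pos) auto
  ultimately show ?thesis by (simp add: zero_less_mult_iff)
qed

lemma wright_neg_has_derivative:
  assumes "0 < \<nu>" "\<nu> < 1"
  shows "((\<lambda>x. wright (- x) (- \<nu>) b) has_real_derivative - wright (- x) (- \<nu>) (b - \<nu>)) (at x)"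
proof -
  have "((\<lambda>x. - x) has_real_derivative - 1) (at x)" by (auto intro!: derivative_eq_intros)
  from DERIV_chain2[OF wright_has_derivative[OF assms] this] show ?thesis by simp
qed

text \<open>If \<open>u y\<close> exceeded both \<open>u a\<close> and its limit 0, then
  \<open>u\<close> would attain a global maximum over \<open>{a..}\<close> at some
  \<open>x > a\<close>. There the first derivative is 0 and the sign lemma makes the second one
  positive, so \<open>u\<close> would grow to the right of \<open>x\<close>.\<close>

lemma wright_no_interior_max:
  fixes \<sigma> :: real
  assumes "0 < \<nu>" "\<nu> < 1/2"
    and lim: "((\<lambda>x. wright (- x) (- \<nu>) 1) \<longlongrightarrow> W) at_top"
    and "0 \<le> a" "a < y"
  shows "\<sigma> * (wright (- y) (- \<nu>) 1 - W) \<le> max (\<sigma> * (wright (- a) (- \<nu>) 1 - W)) 0"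
proof (rule ccontr)
  define u where "u = (\<lambda>x. \<sigma> * (wright (- x) (- \<nu>) 1 - W))"
  have \<nu>: "0 < \<nu>" "\<nu> < 1" using assms by auto
  assume "\<not> ?thesis"
  then have y: "u y > u a" "u y > 0" by (auto simp: u_def)
  have du: "(u has_real_derivative - \<sigma> * wright (- x) (- \<nu>) (1 - \<nu>)) (at x)" for x
    unfolding u_def by (auto intro!: derivative_eq_intros wright_neg_has_derivative[OF \<nu>])
  have ddu: "((\<lambda>x. - \<sigma> * wright (- x) (- \<nu>) (1 - \<nu>)) has_real_derivative \<sigma> * wright (- x) (- \<nu>) (1 - 2 * \<nu>)) (at x)" for x
    using wright_neg_has_derivative[OF \<nu>, of "1 - \<nu>" x] by (auto intro!: derivative_eq_intros)
  have "(u \<longlongrightarrow> \<sigma> * (W - W)) at_top"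
    unfolding u_def by (intro tendsto_intros lim)
  then have "eventually (\<lambda>x. u x < u y) at_top"
    using y by (intro order_tendstoD(2)[of u 0]) auto
  then obtain N where N: "\<And>x. x \<ge> N \<Longrightarrow> u x < u y"
    by (auto simp: eventually_at_top_linorder)
  have cont: "continuous_on S u" for S
    using du by (meson DERIV_isCont continuous_at_imp_continuous_on)
  \<comment> \<open>Past \<open>N\<close> the function stays below \<open>u y\<close>, so a maximum
    over this compact interval is global on \<open>{a..}\<close>.\<close>
  obtain x where x: "x \<in> {a..max y N}" "\<And>z. z \<in> {a..max y N} \<Longrightarrow> u z \<le> u x"
    using continuous_attains_sup[of "{a..max y N}" u] cont assms by force
  have xy: "u y \<le> u x" using x(2)[of y] assms by auto
  then have "x > a" using x(1) y by (cases "x = a") auto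
  have glob: "u z \<le> u x" if "z \<ge> a" for z
  proof (cases "z \<le> max y N")
    case True then show ?thesis using x(2) that by auto
  next
    case False
    then have "u z < u y" by (intro N) auto
    then show ?thesis using xy by simp
  qed
  have "- \<sigma> * wright (- x) (- \<nu>) (1 - \<nu>) = 0"
  proof (rule DERIV_local_max[OF du])
    show "x - a > 0" using \<open>x > a\<close> by simp
    show "\<forall>z. \<bar>x - z\<bar> < x - a \<longrightarrow> u z \<le> u x" using glob by auto
  qed
  moreover have pos: "\<sigma> * wright (- x) (- \<nu>) (1 - 2 * \<nu>) > 0"
  proof (rule wright_second_derivative_sign_at_max[OF assms(1,2) _ lim])
    show "x > 0" using \<open>x > a\<close> assms by simp
    show "\<sigma> * W < \<sigma> * wright (- x) (- \<nu>) 1" using xy y by (simp add: u_def algebra_simps)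
    show "\<sigma> * wright (- z) (- \<nu>) 1 \<le> \<sigma> * wright (- x) (- \<nu>) 1" if "z \<ge> x" for z
      using glob[of z] that \<open>x > a\<close> by (simp add: u_def algebra_simps)
  qed
  ultimately obtain d where d: "d > 0" "\<And>h. 0 < h \<Longrightarrow> h < d \<Longrightarrow> 0 < - \<sigma> * wright (- (x + h)) (- \<nu>) (1 - \<nu>)"
    using DERIV_pos_inc_right[OF ddu pos] by auto
  have "u x < u (x + d/2)"
  proof (rule DERIV_pos_imp_increasing_open[of x "x + d/2" u])
    fix z assume "x < z" "z < x + d / 2"
    then show "\<exists>v. (u has_real_derivative v) (at z) \<and> 0 < v"
      using du[of z] d(2)[of "z - x"] d(1) by (intro exI[of _ "- \<sigma> * wright (- z) (- \<nu>) (1 - \<nu>)"]) auto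
  qed (use d cont in auto)
  with glob[of "x + d/2"] \<open>x > a\<close> d(1) show False by auto
qed

text \<open>The complex power series is entire; vanishing on a real ray would force it to vanish at
  0, where its value is \<open>rGamma b\<close>.\<close>

lemma wright_not_eventually_zero:
  assumes "0 < \<nu>" "\<nu> < 1" "rGamma b \<noteq> 0"
  shows "\<exists>x>a. wright (- x) (- \<nu>) b \<noteq> 0"
proof (rule ccontr)
  assume "\<not> ?thesis"
  then have zero: "wright (- x) (- \<nu>) b = 0" if "x > a" for x using that by auto
  define c where "c = (\<lambda>n. rGamma (real n * (- \<nu>) + b) / fact n)"
  define F where "F = (\<lambda>z::complex. \<Sum>n. of_real (c n) * z ^ n)"
  have sm: "summable (\<lambda>n. of_real (c n) * z ^ n)" for z :: complex
    unfolding c_def by (rule wright_coeff_summable[OF assms(1,2)])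
  have "F holomorphic_on UNIV"
    unfolding F_def holomorphic_on_open[OF open_UNIV]
    using termdiffs_strong_converges_everywhere[OF sm] by blast
  moreover have Freal: "F (of_real x) = of_real (wright x (- \<nu>) b)" for x
  proof -
    have "(\<lambda>n. c n * x ^ n) sums wright x (- \<nu>) b"
      unfolding c_def wright_altdef using wright_coeff_summable[OF assms(1,2), of b x] by (simp add: summable_sums)
    from sums_of_real[OF this] have "(\<lambda>n. of_real (c n) * of_real x ^ n) sums complex_of_real (wright x (- \<nu>) b)"
      by simp
    then show ?thesis unfolding F_def by (simp add: sums_iff)
  qed
  \<comment> \<open>\<open>- a - 1\<close> is interior to the ray of zeros and serves as
    accumulation point for the identity theorem.\<close>
  moreover have "of_real (- a - 1) islimpt (complex_of_real ` {..<- a})"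
  proof (rule islimpt_isCont_image)
    show "(- a - 1) islimpt {..<- a}" by (rule interior_limit_point) (simp add: interior_open)
  qed (simp_all add: eventually_at_filter del: of_real_diff of_real_minus)
  moreover have "F z = 0" if "z \<in> complex_of_real ` {..<- a}" for z
    using that zero[of "- x" for x] Freal by force
  ultimately have "F 0 = 0"
    by (intro analytic_continuation[of F UNIV "complex_of_real ` {..<- a}" "of_real (- a - 1)" 0]) auto
  then have "wright 0 (- \<nu>) b = 0" using Freal[of 0] by simp
  with assms(3) show False by simp
qed

text \<open>The chain is \<open>W < 1\<close>, \<open>w \<ge> W\<close>, \<open>w\<close>
  decreasing, \<open>w > W\<close>. Then \<open>w\<close> has at every \<open>x > 0\<close> a
  maximum over \<open>{x..}\<close> above \<open>W\<close>, so the sign lemma applies everywhere,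
  \<open>m\<close> decreases strictly and, being nonnegative, is positive.\<close>

lemma wright_strict_positivity:
  assumes "0 < \<nu>" "\<nu> < 1/2"
  obtains W where "((\<lambda>x. wright (- x) (- \<nu>) 1) \<longlongrightarrow> W) at_top"
    and "\<And>x. x \<ge> 0 \<Longrightarrow> wright (- x) (- \<nu>) 1 \<ge> W"
    and "\<And>x. x \<ge> 0 \<Longrightarrow> wright (- x) (- \<nu>) (1 - \<nu>) > 0"
    and "\<And>x. x > 0 \<Longrightarrow> wright (- x) (- \<nu>) (1 - 2 * \<nu>) > 0"
proof -
  have \<nu>: "0 < \<nu>" "\<nu> < 1" using assms by auto
  define w where "w = (\<lambda>x. wright (- x) (- \<nu>) 1)"
  define m where "m = (\<lambda>x. wright (- x) (- \<nu>) (1 - \<nu>))"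
  obtain W where lim: "((\<lambda>x. wright (- x) (- \<nu>) 1) \<longlongrightarrow> W) at_top"
    using wright_limit_at_top[OF \<nu>] .
  have nmax: "\<sigma> * (w y - W) \<le> max (\<sigma> * (w a - W)) 0" if "0 \<le> a" "a < y" for a y \<sigma>
    unfolding w_def by (rule wright_no_interior_max[OF assms lim that])
  have dw: "(w has_real_derivative - m x) (at x)" for x
    unfolding w_def m_def by (rule wright_neg_has_derivative[OF \<nu>])
  have w0: "w 0 = 1" by (simp add: w_def)
  have m0: "m 0 > 0" using \<nu> by (simp add: m_def rGamma_inverse_Gamma Gamma_real_pos)
  \<comment> \<open>If \<open>W \<ge> 1\<close>, the principle with \<open>\<sigma> = -1\<close>
    forces \<open>w y \<ge> w 0\<close> for \<open>y > 0\<close>, against the slope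
    \<open>- m 0 < 0\<close> at 0.\<close>
  have "W < 1"
  proof (rule ccontr)
    assume "\<not> W < 1"
    then have "w y \<le> W" if "y > 0" for y using nmax[of 0 y 1] that w0 by auto
    then have le: "w 0 \<le> w y" if "y > 0" for y
      using nmax[of 0 y "-1"] that w0 \<open>\<not> W < 1\<close> by (auto simp: max_def split: if_splits)
    obtain d where d: "d > 0" "\<And>h. 0 < h \<Longrightarrow> h < d \<Longrightarrow> w (0 + h) < w 0"
      using DERIV_neg_dec_right[OF dw, of 0] m0 by auto
    show False using le[of "d/2"] d(2)[of "d/2"] d(1) by simp
  qed
  have wW: "w x \<ge> W" if "x \<ge> 0" for x
    using nmax[of 0 x "-1"] that w0 \<open>W < 1\<close> by (cases "x = 0") (auto simp: max_def split: if_splits)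
  have anti: "w y \<le> w x" if "0 \<le> x" "x \<le> y" for x y
    using nmax[of x y 1] that wW[of x] by (cases "x = y") (auto simp: max_def split: if_splits)
  \<comment> \<open>Equality at \<open>x\<close> would freeze \<open>w\<close> at \<open>W\<close>
    from there on, so \<open>m\<close> would vanish on a ray, which analyticity excludes.\<close>
  have strict: "w x > W" if "x \<ge> 0" for x
  proof (rule ccontr)
    assume "\<not> w x > W"
    then have const: "w y = W" if "y \<ge> x" for y
      using anti[of x y] wW[of y] wW[of x] that \<open>x \<ge> 0\<close> by auto
    have "m y = 0" if "y > x" for y
    proof -
      have "((\<lambda>_. W) has_real_derivative - m y) (at y)"
        by (rule has_field_derivative_transform_within_open[OF dw, of "{x<..}"])
           (use that const in auto)
      moreover have "((\<lambda>_. W) has_real_derivative 0) (at y)" by simp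
      ultimately show ?thesis by (metis DERIV_unique neg_equal_0_iff_equal)
    qed
    moreover have "rGamma (1 - \<nu>) \<noteq> 0" using m0 by (simp add: m_def)
    ultimately show False
      using wright_not_eventually_zero[OF \<nu>, of "1 - \<nu>" x] by (auto simp: m_def)
  qed
  have pos2: "wright (- x) (- \<nu>) (1 - 2 * \<nu>) > 0" if "x > 0" for x
    using wright_second_derivative_sign_at_max[OF assms that lim, of 1] strict[of x] anti[of x] that
    by (simp add: w_def)
  have m_nonneg: "m x \<ge> 0" if "x \<ge> 0" for x
  proof (rule ccontr)
    assume "\<not> m x \<ge> 0"
    then obtain d where d: "d > 0" "\<And>h. 0 < h \<Longrightarrow> h < d \<Longrightarrow> w x < w (x + h)"
      using DERIV_pos_inc_right[OF dw, of x] by auto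
    show False using anti[of x "x + d/2"] d(2)[of "d/2"] d(1) that by simp
  qed
  have m_dec: "m y < m x" if "0 \<le> x" "x < y" for x y
  proof (rule DERIV_neg_imp_decreasing_open[of x y m, OF \<open>x < y\<close>])
    have dm: "(m has_real_derivative - wright (- z) (- \<nu>) (1 - 2 * \<nu>)) (at z)" for z
      using wright_neg_has_derivative[OF \<nu>, of "1 - \<nu>" z] by (simp add: m_def)
    then show "continuous_on {x..y} m"
      by (meson DERIV_isCont continuous_at_imp_continuous_on)
    fix z assume "x < z" "z < y"
    then show "\<exists>v. (m has_real_derivative v) (at z) \<and> v < 0"
      using dm[of z] pos2[of z] that by (intro exI[of _ "- wright (- z) (- \<nu>) (1 - 2 * \<nu>)"]) auto
  qed
  have "m x > 0" if "x \<ge> 0" for x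
    using m_dec[of x "x + 1"] m_nonneg[of "x + 1"] that by simp
  with that[OF lim] wW pos2 show thesis by (simp add: w_def m_def)
qed

section \<open>The similarity solution\<close>

lemma mainardi_eq_wright: "mainardi \<nu> x = wright (- x) (- \<nu>) (1 - \<nu>)"
  by (simp add: mainardi_def)

lemma mainardi_0: "mainardi \<nu> 0 = 1 / Gamma (1 - \<nu>)"
  by (simp add: mainardi_def rGamma_inverse_Gamma inverse_eq_divide)

lemma mainardi_has_derivative:
  assumes "0 < \<nu>" "\<nu> < 1"
  shows "(mainardi \<nu> has_real_derivative - wright (- x) (- \<nu>) (1 - 2 * \<nu>)) (at x)"
  using wright_neg_has_derivative[OF assms, of "1 - \<nu>" x] by (simp add: mainardi_eq_wright[abs_def])

lemma mainardi_pos: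
  assumes "0 < \<nu>" "\<nu> < 1/2" "x \<ge> 0"
  shows "mainardi \<nu> x > 0"
  using wright_strict_positivity[OF assms(1,2)] assms(3) by (metis mainardi_eq_wright)

lemma mainardi_strict_decreasing:
  assumes "0 < \<nu>" "\<nu> < 1/2" "0 \<le> x" "x < y"
  shows "mainardi \<nu> y < mainardi \<nu> x"
proof (rule DERIV_neg_imp_decreasing_open[of x y "mainardi \<nu>", OF \<open>x < y\<close>])
  have d: "(mainardi \<nu> has_real_derivative - wright (- z) (- \<nu>) (1 - 2 * \<nu>)) (at z)" for z
    using assms by (intro mainardi_has_derivative) auto
  then show "continuous_on {x..y} (mainardi \<nu>)"
    by (meson DERIV_isCont continuous_at_imp_continuous_on)
  fix z assume z: "x < z" "z < y"
  then have "wright (- z) (- \<nu>) (1 - 2 * \<nu>) > 0"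
    using wright_strict_positivity[OF assms(1,2)] assms(3) by (metis order_le_less_trans)
  then show "\<exists>v. (mainardi \<nu> has_real_derivative v) (at z) \<and> v < 0"
    using d[of z] by (intro exI[of _ "- wright (- z) (- \<nu>) (1 - 2 * \<nu>)"]) auto
qed

section \<open>The equation for \<xi>\<close>

lemma wright_complement_mvt:
  assumes "0 < \<nu>" "\<nu> < 1" "x > 0"
  obtains z where "0 < z" "z < x" "1 - wright (- x) (- \<nu>) 1 = x * mainardi \<nu> z"
proof -
  have d: "((\<lambda>x. 1 - wright (- x) (- \<nu>) 1) has_real_derivative mainardi \<nu> z) (at z)" for z
    using DERIV_diff[OF DERIV_const wright_neg_has_derivative[OF assms(1,2), of 1 z], of 1]
    by (simp add: mainardi_eq_wright)
  show ?thesis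
    using MVT2[OF assms(3) d] that by force
qed

lemma wright_complement_pos:
  assumes "0 < \<nu>" "\<nu> < 1/2" "x > 0"
  shows "1 - wright (- x) (- \<nu>) 1 > 0"
proof -
  obtain z where "0 < z" "1 - wright (- x) (- \<nu>) 1 = x * mainardi \<nu> z"
    using wright_complement_mvt[of \<nu> x] assms by auto
  then show ?thesis using mainardi_pos[of \<nu> z] assms by simp
qed

text \<open>\<open>f x / x\<close> is the mean of the decreasing function \<open>M\<close> over
  \<open>{0..x}\<close>; it exceeds \<open>M x\<close> and decreases as well. So \<open>g\<close> is
  a product of two positive strictly decreasing factors, which gives uniqueness; existence follows
  by the intermediate value theorem.\<close>

lemma wright_mainardi_equation_unique:
  assumes "0 < \<nu>" "\<nu> < 1/2" "0 < C" "C < (1 / Gamma (1 - \<nu>))\<^sup>2"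
  shows "\<exists>!\<xi>. \<xi> > 0 \<and> (1 - wright (- \<xi>) (- \<nu>) 1) / \<xi> * mainardi \<nu> \<xi> = C"
proof -
  have \<nu>: "0 < \<nu>" "\<nu> < 1" using assms by auto
  define f where "f = (\<lambda>x. 1 - wright (- x) (- \<nu>) 1)"
  define M where "M = mainardi \<nu>"
  define g where "g = (\<lambda>x. f x / x * M x)"
  have df: "(f has_real_derivative M x) (at x)" for x
    unfolding f_def M_def mainardi_eq_wright
    using DERIV_diff[OF DERIV_const wright_neg_has_derivative[OF \<nu>, of 1 x], of 1] by simp
  have Mpos: "M x > 0" if "x \<ge> 0" for x
    unfolding M_def using assms that by (intro mainardi_pos)
  have Mdec: "M y < M x" if "0 \<le> x" "x < y" for x y
    unfolding M_def using assms that by (intro mainardi_strict_decreasing)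
  have f_gt: "f x > x * M x" and f_pos: "f x > 0" if "x > 0" for x
  proof -
    obtain z where z: "0 < z" "z < x" "f x = x * M z"
      using wright_complement_mvt[OF \<nu> \<open>x > 0\<close>] unfolding f_def M_def by blast
    then show "f x > x * M x" "f x > 0" using Mdec[of z x] Mpos[of z] that by auto
  qed
  have contM: "isCont M x" for x
    unfolding M_def by (rule DERIV_isCont[OF mainardi_has_derivative[OF \<nu>]])
  have contg: "continuous_on {a..b} g" if "a > 0" for a b
  proof -
    have "isCont g x" if "x > 0" for x
      unfolding g_def using that DERIV_isCont[OF df[of x]] contM[of x] by (auto intro!: continuous_intros)
    then show ?thesis using that by (auto intro!: continuous_at_imp_continuous_on)
  qed
  have gdec: "g y < g x" if "0 < x" "x < y" for x y
  proof -
    \<comment> \<open>The derivative has numerator \<open>z * M z - f z\<close>, negative by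
      \<open>f_gt\<close>.\<close>
    have "f y / y < f x / x"
    proof (rule DERIV_neg_imp_decreasing[of x y "\<lambda>x. f x / x", OF \<open>x < y\<close>])
      fix z assume z: "x \<le> z" "z \<le> y"
      then have z0: "z > 0" using that by simp
      have "((\<lambda>x. f x / x) has_real_derivative (M z * z - f z * 1) / (z * z)) (at z)"
        using z0 by (intro DERIV_divide df DERIV_ident) auto
      moreover have "(M z * z - f z * 1) / (z * z) < 0"
        using f_gt[OF z0] z0 by (simp add: divide_neg_pos mult.commute)
      ultimately show "\<exists>v. ((\<lambda>x. f x / x) has_real_derivative v) (at z) \<and> v < 0" by blast
    qed
    moreover have "f x / x > 0" using f_pos[of x] that by simp
    ultimately show ?thesis
      unfolding g_def using Mdec[of x y] Mpos[of y] that by (intro mult_strict_mono) auto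
  qed
  obtain W where W: "\<And>x. x \<ge> 0 \<Longrightarrow> wright (- x) (- \<nu>) 1 \<ge> W"
    by (rule wright_strict_positivity[OF assms(1,2)]) (rule that)
  \<comment> \<open>From \<open>w \<ge> W\<close> and \<open>M x < M 0\<close>, the product
    \<open>f x * M x\<close> is at most \<open>B\<close>, so \<open>g\<close> decays at least like
    \<open>1 / x\<close>.\<close>
  define B where "B = (1 - W) * M 0"
  have gB: "g x \<le> B / x" if "x > 0" for x
  proof -
    have "f x * M x \<le> (1 - W) * M 0"
      using W[of x] f_pos[OF that] Mdec[of 0 x] Mpos[of x] that
      by (intro mult_mono) (auto simp: f_def)
    then show ?thesis using that by (simp add: g_def B_def divide_right_mono)
  qed
  have "isCont (\<lambda>x. (M x)\<^sup>2) 0"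
    using contM[of 0] by (intro continuous_intros)
  then have "((\<lambda>x. (M x)\<^sup>2) \<longlongrightarrow> (M 0)\<^sup>2) (at_right 0)"
    unfolding isCont_def by (rule tendsto_mono[rotated]) (simp add: at_le)
  \<comment> \<open>By continuity \<open>C < (M a)\<^sup>2\<close> for some small \<open>a\<close>,
    and \<open>(M a)\<^sup>2 \<le> g a\<close> by \<open>f_gt\<close>; this is the left end
    point.\<close>
  then have "eventually (\<lambda>x. C < (M x)\<^sup>2) (at_right 0)"
    using assms(4) by (intro order_tendstoD(1)) (auto simp: M_def mainardi_0)
  moreover have "eventually (\<lambda>x::real. x \<in> {0<..<1}) (at_right 0)"
    by (rule eventually_at_right_real) simp
  ultimately have "eventually (\<lambda>x. C < (M x)\<^sup>2 \<and> x \<in> {0<..<1}) (at_right 0)"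
    by (rule eventually_conj)
  then obtain a where a: "C < (M a)\<^sup>2" "0 < a" "a < 1"
    using eventually_happens'[OF trivial_limit_at_right_real] by force
  have "(M a)\<^sup>2 = M a * M a" by (simp add: power2_eq_square)
  also have "\<dots> \<le> g a"
    unfolding g_def using f_gt[of a] Mpos[of a] a by (intro mult_right_mono) (auto simp: field_simps)
  finally have ga: "C \<le> g a" using a by simp
  \<comment> \<open>\<open>B / C\<close> ensures \<open>B / b \<le> C\<close>; the 1 keeps
    \<open>b\<close> to the right of \<open>a\<close>.\<close>
  define b where "b = max 1 (B / C)"
  have b: "b \<ge> 1" "B / C \<le> b" by (auto simp: b_def)
  have "g b \<le> B / b" using gB[of b] b by simp
  also have "B / b \<le> C" using b assms by (simp add: field_simps)
  finally have "g b \<le> C" .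
  then obtain \<xi> where \<xi>: "a \<le> \<xi>" "g \<xi> = C"
    using IVT2'[of g b C a] ga contg[of a b] a b by auto
  show ?thesis
  proof (rule ex1I[of _ \<xi>])
    show "\<xi> > 0 \<and> (1 - wright (- \<xi>) (- \<nu>) 1) / \<xi> * mainardi \<nu> \<xi> = C"
      using \<xi> a by (simp add: g_def f_def M_def)
    fix y assume y: "y > 0 \<and> (1 - wright (- y) (- \<nu>) 1) / y * mainardi \<nu> y = C"
    then have "g y = C" by (simp add: g_def f_def M_def)
    then show "y = \<xi>"
      using gdec[of y \<xi>] gdec[of \<xi> y] \<xi> a y by (cases y \<xi> rule: linorder_cases) auto
  qed
qed

section \<open>Caputo derivatives and the Stefan conditions\<close>

lemma has_integral_power_kernel:
  assumes "0 < p" "0 < r" "t > (0::real)"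
  shows "((\<lambda>\<tau>. \<tau> powr (p - 1) * (t - \<tau>) powr (r - 1)) has_integral t powr (p + r - 1) * Beta p r) {0..t}"
proof -
  have "((\<lambda>\<tau>. (1/t * \<tau>) powr (p - 1) * (1 - 1/t * \<tau>) powr (r - 1)) has_integral (1 / \<bar>1/t\<bar>) *\<^sub>R Beta p r) ((\<lambda>x. x / (1/t)) ` {0..1})"
    using assms by (intro has_integral_stretch_real[OF has_integral_Beta_real]) auto
  moreover have "(\<lambda>x. x / (1/t)) ` {0..1} = {0..t}"
  proof -
    have "(\<lambda>x. x / (1/t)) = (\<lambda>x. x * t)" using assms by auto
    then show ?thesis using assms image_mult_atLeastAtMost[of t 0 1] by (simp add: mult.commute[of _ t])
  qed
  ultimately have "((\<lambda>\<tau>. (1/t * \<tau>) powr (p - 1) * (1 - 1/t * \<tau>) powr (r - 1)) has_integral t * Beta p r) {0..t}"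
    using assms by simp
  from has_integral_mult_right[OF this, of "t powr (p + r - 2)"]
  have h1: "((\<lambda>\<tau>. t powr (p + r - 2) * ((1/t * \<tau>) powr (p - 1) * (1 - 1/t * \<tau>) powr (r - 1))) has_integral t powr (p + r - 2) * (t * Beta p r)) {0..t}" .
  have e1: "t powr (p + r - 2) * (t * Beta p r) = t powr (p + r - 1) * Beta p r"
    using assms by (simp add: powr_diff power2_eq_square)
  have e2: "t powr (p + r - 2) * ((1/t * \<tau>) powr (p - 1) * (1 - 1/t * \<tau>) powr (r - 1)) = \<tau> powr (p - 1) * (t - \<tau>) powr (r - 1)"
    if "\<tau> \<in> {0..t}" for \<tau>
  proof -
    have "1 - 1/t * \<tau> = (t - \<tau>) / t" using assms by (simp add: field_simps)
    moreover have "((t - \<tau>) / t) powr (r - 1) = (t - \<tau>) powr (r - 1) / t powr (r - 1)"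
      by (rule powr_divide)
    moreover have "(1/t * \<tau>) powr (p - 1) = \<tau> powr (p - 1) / t powr (p - 1)"
      using assms that by (simp add: powr_divide)
    moreover have "t powr (p + r - 2) = t powr (p - 1) * t powr (r - 1)"
      by (simp flip: powr_add)
    ultimately show ?thesis using assms by simp
  qed
  show ?thesis using has_integral_eq[OF e2 h1] unfolding e1 .
qed

text \<open>The derivative is given for positive times; whatever \<open>deriv f 0\<close> is, it
  alters the integrand at a single point.\<close>

lemma caputoI:
  assumes "\<And>\<tau>. 0 < \<tau> \<Longrightarrow> (f has_real_derivative f' \<tau>) (at \<tau>)"
    and "((\<lambda>\<tau>. f' \<tau> / (t - \<tau>) powr \<alpha>) has_integral I) {0..t}"
  shows "caputo_exists \<alpha> f t" and "caputo \<alpha> f t = I / Gamma (1 - \<alpha>)"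
proof -
  have I: "((\<lambda>\<tau>. deriv f \<tau> / (t - \<tau>) powr \<alpha>) has_integral I) {0..t}"
    by (rule has_integral_spike_finite[OF _ _ assms(2), of "{0}"])
       (auto simp: DERIV_imp_deriv[OF assms(1)])
  have "f differentiable (at \<tau>)" if "0 < \<tau>" for \<tau>
    using assms(1)[OF that] unfolding real_differentiable_def by blast
  with I show "caputo_exists \<alpha> f t"
    by (auto simp: caputo_exists_def)
  show "caputo \<alpha> f t = I / Gamma (1 - \<alpha>)"
    using integral_unique[OF I] by (simp add: caputo_def)
qed

lemma caputo_powr:
  assumes "0 < p" "0 < \<alpha>" "\<alpha> < 1" "t > 0"
  shows "caputo_exists \<alpha> (\<lambda>\<tau>. S * \<tau> powr p) t"
    and "caputo \<alpha> (\<lambda>\<tau>. S * \<tau> powr p) t = S * Gamma (1 + p) / Gamma (1 + p - \<alpha>) * t powr (p - \<alpha>)"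
proof -
  have d: "((\<lambda>\<tau>. S * \<tau> powr p) has_real_derivative S * p * \<tau> powr (p - 1)) (at \<tau>)" if "\<tau> > 0" for \<tau>
    using that by (auto intro!: derivative_eq_intros)
  have "((\<lambda>\<tau>. (S * p) * (\<tau> powr (p - 1) * (t - \<tau>) powr ((1 - \<alpha>) - 1))) has_integral (S * p) * (t powr (p + (1 - \<alpha>) - 1) * Beta p (1 - \<alpha>))) {0..t}"
    using assms by (intro has_integral_mult_right has_integral_power_kernel) auto
  then have i: "((\<lambda>\<tau>. S * p * \<tau> powr (p - 1) / (t - \<tau>) powr \<alpha>) has_integral (S * p) * (t powr (p - \<alpha>) * Beta p (1 - \<alpha>))) {0..t}"
    by (simp add: powr_minus_divide)
  show "caputo_exists \<alpha> (\<lambda>\<tau>. S * \<tau> powr p) t"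
    using caputoI(1)[OF d i] .
  \<comment> \<open>\<open>p * Gamma p\<close> combines to \<open>Gamma (1 + p)\<close>, and the
    \<open>Gamma (1 - \<alpha>)\<close> inside the Beta function cancels the Caputo
    normalisation.\<close>
  have "Gamma (1 + p) = p * Gamma p"
    using assms by (subst add.commute, intro Gamma_plus1) (auto dest: nonpos_Ints_nonpos)
  moreover have "Gamma (1 - \<alpha>) > 0" using assms by (intro Gamma_real_pos) auto
  ultimately show "caputo \<alpha> (\<lambda>\<tau>. S * \<tau> powr p) t = S * Gamma (1 + p) / Gamma (1 + p - \<alpha>) * t powr (p - \<alpha>)"
    using caputoI(2)[OF d i] by (simp add: Beta_def algebra_simps)
qed

text \<open>The time derivative of \<open>F\<close> is \<open>B\<close> times the stable density, so
  the Caputo integral is the Abel integral with \<open>b = 1 - \<alpha>\<close>, and its factor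
  \<open>Gamma (1 - \<alpha>)\<close> cancels.\<close>

lemma caputo_wright_similarity:
  fixes a B x lam t :: real
  assumes "0 < \<alpha>" "\<alpha> < 1" "x > 0" "lam > 0" "t > 0"
  defines "\<nu> \<equiv> \<alpha> / 2"
  defines "F \<equiv> \<lambda>\<tau>. a - B * (1 - wright (- (x / (lam * \<tau> powr \<nu>))) (- \<nu>) 1)"
  shows "caputo_exists \<alpha> F t"
    and "caputo \<alpha> F t = B * t powr (- \<alpha>) * wright (- (x / (lam * t powr \<nu>))) (- \<nu>) (1 - 2 * \<nu>)"
proof -
  have \<nu>: "0 < \<nu>" "\<nu> < 1" "\<alpha> = 2 * \<nu>" using assms by auto
  have xl: "x / lam > 0" using assms by simp
  have e: "x / (lam * \<tau> powr \<nu>) = x / lam * \<tau> powr (- \<nu>)" for \<tau>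
    by (simp add: powr_minus_divide)
  have d: "(F has_real_derivative B * levy_density \<nu> (x / lam) \<tau>) (at \<tau>)" if "\<tau> > 0" for \<tau>
  proof -
    have "(F has_real_derivative 0 - B * (0 - levy_density \<nu> (x / lam) \<tau>)) (at \<tau>)"
      unfolding F_def e
      by (intro DERIV_diff DERIV_const DERIV_cmult wright_similarity_derivative[OF \<nu>(1,2) xl that])
    then show ?thesis by simp
  qed
  have b: "0 < 1 - \<alpha>" "1 - \<alpha> < 1" using assms by auto
  have r: "1 - (1 - \<alpha>) = \<alpha>" "1 - \<alpha> - 1 = - \<alpha>" by auto
  note has_integral_mult_right[OF levy_density_abel_integral[OF \<nu>(1,2) b xl \<open>t > 0\<close>], of B]
  then have i: "((\<lambda>\<tau>. B * levy_density \<nu> (x / lam) \<tau> / (t - \<tau>) powr \<alpha>) has_integral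
    B * (Gamma (1 - \<alpha>) * t powr (- \<alpha>) * wright (- (x / (lam * t powr \<nu>))) (- \<nu>) (1 - \<alpha>))) {0..t}"
    unfolding e r times_divide_eq_right .
  show "caputo_exists \<alpha> F t" using caputoI(1)[OF d i] .
  have "Gamma (1 - \<alpha>) > 0" using assms by (intro Gamma_real_pos) auto
  then show "caputo \<alpha> F t = B * t powr (- \<alpha>) * wright (- (x / (lam * t powr \<nu>))) (- \<nu>) (1 - 2 * \<nu>)"
    using caputoI(2)[OF d i] \<nu>(3) by simp
qed

text \<open>Reduces the Stefan problem to algebra: the similarity form removes \<open>x\<close> and
  \<open>t\<close>, and the assumptions on \<open>lam\<close> and \<open>A\<close> are what the
  diffusion equation, the front temperature, the front balance and the flux leave behind.\<close>

lemma stefan_sol_similarity: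
  fixes \<alpha> \<rho> k c L Tm T0 q0 \<xi> lam A :: real
  assumes "0 < \<alpha>" "\<alpha> < 1" "c > 0" "lam > 0" "\<xi> > 0"
  defines "\<nu> \<equiv> \<alpha> / 2"
  assumes lam: "lam\<^sup>2 = k / (\<rho> * c)"
    and A: "A * (1 - wright (- \<xi>) (- \<nu>) 1) = T0 - Tm"
    and front: "k * A * mainardi \<nu> \<xi> = \<rho> * L * lam\<^sup>2 * \<xi> * Gamma (1 + \<nu>) / Gamma (1 - \<nu>)"
    and flux: "k * A / (Gamma (1 - \<nu>) * lam) = q0"
  shows "stefan_sol \<alpha> \<rho> k c L Tm T0 q0
    (\<lambda>x t. T0 - A * (1 - wright (- (x / (lam * t powr \<nu>))) (- \<nu>) 1)) (\<lambda>t. lam * \<xi> * t powr \<nu>)"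
proof -
  have \<nu>: "0 < \<nu>" "\<nu> < 1" "\<alpha> = 2 * \<nu>" using assms by auto
  define T where "T = (\<lambda>x t. T0 - A * (1 - wright (- (x / (lam * t powr \<nu>))) (- \<nu>) 1))"
  define s where "s = (\<lambda>t. lam * \<xi> * t powr \<nu>)"
  have l: "lam * t powr \<nu> > 0" if "t > 0" for t using that assms by simp
  have scale: "((\<lambda>z. wright (- (z / r)) (- \<nu>) b) has_real_derivative - wright (- (y / r)) (- \<nu>) (b - \<nu>) * (1 / r)) (at y)"
    if "r > 0" for r b y
  proof (rule DERIV_chain2[OF wright_neg_has_derivative[OF \<nu>(1,2)]])
    show "((\<lambda>z. z / r) has_real_derivative 1 / r) (at y)"
      using that by (auto intro!: derivative_eq_intros)
  qed
  have Tx: "((\<lambda>z. T z t) has_real_derivative - A / (lam * t powr \<nu>) * mainardi \<nu> (y / (lam * t powr \<nu>))) (at y)"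
    if "t > 0" for t y
  proof -
    have "((\<lambda>z. T z t) has_real_derivative
      0 - A * (0 - - wright (- (y / (lam * t powr \<nu>))) (- \<nu>) (1 - \<nu>) * (1 / (lam * t powr \<nu>)))) (at y)"
      unfolding T_def by (intro DERIV_diff DERIV_const DERIV_cmult scale l that)
    then show ?thesis by (simp add: mainardi_eq_wright)
  qed
  have dT: "deriv (\<lambda>z. T z t) = (\<lambda>y. - A / (lam * t powr \<nu>) * mainardi \<nu> (y / (lam * t powr \<nu>)))" if "t > 0" for t
    using DERIV_imp_deriv[OF Tx[OF that]] by auto
  have Txx: "(deriv (\<lambda>z. T z t) has_real_derivative A / (lam * t powr \<nu>)\<^sup>2 * wright (- (y / (lam * t powr \<nu>))) (- \<nu>) (1 - 2 * \<nu>)) (at y)"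
    if "t > 0" for t y
  proof -
    have "1 - \<nu> - \<nu> = 1 - 2 * \<nu>" by simp
    then show ?thesis
      unfolding dT[OF that] mainardi_eq_wright
      using DERIV_cmult[OF scale[OF l[OF that], of "1 - \<nu>" y], of "- A / (lam * t powr \<nu>)"]
      by (simp add: power2_eq_square)
  qed
  have sol: "caputo_exists \<alpha> (T x) t" "caputo \<alpha> (T x) t = k / (\<rho> * c) * deriv (deriv (\<lambda>z. T z t)) x"
    if "t > 0" "x > 0" for x t
  proof -
    note C = caputo_wright_similarity[OF assms(1,2) that(2) assms(4) that(1), of T0 A, folded \<nu>_def]
    show "caputo_exists \<alpha> (T x) t" using C(1) unfolding T_def .
    have "caputo \<alpha> (T x) t = A * t powr (- \<alpha>) * wright (- (x / (lam * t powr \<nu>))) (- \<nu>) (1 - 2 * \<nu>)"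
      using C(2) unfolding T_def .
    moreover have "deriv (deriv (\<lambda>z. T z t)) x = A / (lam * t powr \<nu>)\<^sup>2 * wright (- (x / (lam * t powr \<nu>))) (- \<nu>) (1 - 2 * \<nu>)"
      by (rule DERIV_imp_deriv[OF Txx[OF that(1)]])
    \<comment> \<open>Two space derivatives lower the Wright parameter to
      \<open>1 - 2 * \<nu>\<close>, as the Caputo derivative does; with this identity the powers of
      \<open>t\<close> agree too, and the diffusivity is \<open>lam\<^sup>2\<close>.\<close>
    moreover have "(lam * t powr \<nu>)\<^sup>2 = lam\<^sup>2 * t powr \<alpha>"
      by (simp add: power_mult_distrib power2_eq_square \<nu>(3) flip: powr_add)
    ultimately show "caputo \<alpha> (T x) t = k / (\<rho> * c) * deriv (deriv (\<lambda>z. T z t)) x"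
      using assms(4) unfolding lam[symmetric] by (simp add: powr_minus_divide)
  qed
  have Tdiff: "(\<lambda>z. T z t) differentiable (at y)" and Tdiff2: "deriv (\<lambda>z. T z t) differentiable (at y)" if "t > 0" for t y
    using Tx[OF that] Txx[OF that] by (auto simp: real_differentiable_def)
  have front': "- k * deriv (\<lambda>z. T z t) (s t) = \<rho> * L * caputo \<alpha> s t" "caputo_exists \<alpha> s t" "T (s t) t = Tm" if "t > 0" for t
  proof -
    have st: "s t / (lam * t powr \<nu>) = \<xi>" using that assms by (simp add: s_def)
    show "T (s t) t = Tm" unfolding T_def st A by simp
    show "caputo_exists \<alpha> s t"
      unfolding s_def using caputo_powr(1)[OF \<nu>(1) assms(1,2) that] .
    have "caputo \<alpha> s t = lam * \<xi> * Gamma (1 + \<nu>) / Gamma (1 - \<nu>) * t powr (- \<nu>)"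
      unfolding s_def caputo_powr(2)[OF \<nu>(1) assms(1,2) that] by (simp add: \<nu>(3))
    moreover have "- k * deriv (\<lambda>z. T z t) (s t) = k * A * mainardi \<nu> \<xi> / lam * t powr (- \<nu>)"
      unfolding dT[OF that] st by (simp add: powr_minus_divide)
    ultimately show "- k * deriv (\<lambda>z. T z t) (s t) = \<rho> * L * caputo \<alpha> s t"
      unfolding front using assms(4) by (simp add: power2_eq_square)
  qed
  have flux': "k * deriv (\<lambda>z. T z t) 0 = - q0 / t powr (\<alpha> / 2)" if "t > 0" for t
    unfolding dT[OF that] flux[symmetric] \<nu>_def[symmetric] by (simp add: mainardi_0)
  \<comment> \<open>\<open>s 0 = 0\<close> because \<open>0 powr \<nu> = 0\<close>, and
    \<open>T 0 t = T0\<close> because the Wright function of parameter 1 is 1 at 0.\<close>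
  have "stefan_sol \<alpha> \<rho> k c L Tm T0 q0 T s"
    unfolding stefan_sol_def
    using assms(3) sol Tdiff Tdiff2 front' flux' \<nu> by (auto simp: s_def[THEN fun_cong, of 0] T_def[THEN fun_cong, THEN fun_cong, of 0])
  then show ?thesis unfolding T_def s_def .
qed

theorem theorem2:
  fixes \<alpha> k \<rho> L Tm T0 q0 :: real
  assumes "0 < \<alpha>" "\<alpha> < 1" "k > 0" "\<rho> > 0" "L > 0" "T0 > Tm" "q0 > 0"
    and "k * \<rho> * L * (T0 - Tm) * Gamma (1 + \<alpha>/2) / (q0^2 * Gamma (1 - \<alpha>/2)) < 1"
  shows "(\<exists>!\<xi>. \<xi> > 0 \<and>
           (1 - wright (- \<xi>) (- \<alpha>/2) 1) / \<xi> =
           k * \<rho> * L * (T0 - Tm) * Gamma (1 + \<alpha>/2) / (q0^2 * Gamma (1 - \<alpha>/2) ^ 3)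
             * (1 / mainardi (\<alpha>/2) \<xi>)) \<and>
         (\<forall>\<xi> c lam T s.
           \<xi> > 0 \<and>
           (1 - wright (- \<xi>) (- \<alpha>/2) 1) / \<xi> =
             k * \<rho> * L * (T0 - Tm) * Gamma (1 + \<alpha>/2) / (q0^2 * Gamma (1 - \<alpha>/2) ^ 3)
               * (1 / mainardi (\<alpha>/2) \<xi>) \<and>
           c = L * Gamma (1 + \<alpha>/2) / ((T0 - Tm) * Gamma (1 - \<alpha>/2))
                 * (\<xi> / mainardi (\<alpha>/2) \<xi>) * (1 - wright (- \<xi>) (- \<alpha>/2) 1) \<and>
           lam = sqrt (k / (\<rho> * c)) \<and>
           T = (\<lambda>x t. T0 - (T0 - Tm) / (1 - wright (- \<xi>) (- \<alpha>/2) 1)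
                      * (1 - wright (- (x / (lam * t powr (\<alpha>/2)))) (- \<alpha>/2) 1)) \<and>
           s = (\<lambda>t. lam * \<xi> * t powr (\<alpha>/2))
         \<longrightarrow> stefan_sol \<alpha> \<rho> k c L Tm T0 q0 T s \<and>
             lam\<^sup>2 = k * (T0 - Tm) * Gamma (1 - \<alpha>/2) / (\<rho> * L * Gamma (1 + \<alpha>/2))
                     * mainardi (\<alpha>/2) \<xi> / (\<xi> * (1 - wright (- \<xi>) (- \<alpha>/2) 1)))"
proof -
  define \<nu> where "\<nu> = \<alpha> / 2"
  have \<nu>: "0 < \<nu>" "\<nu> < 1/2" using assms by (auto simp: \<nu>_def)
  define G1 where "G1 = Gamma (1 - \<nu>)"
  define G2 where "G2 = Gamma (1 + \<nu>)"
  define K where "K = k * \<rho> * L * (T0 - Tm) * G2 / (q0\<^sup>2 * G1 ^ 3)"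
  define \<theta> where "\<theta> = T0 - Tm"
  have pos: "G1 > 0" "G2 > 0" "\<theta> > 0" using \<nu> assms by (auto simp: G1_def G2_def \<theta>_def)
  have neg_half: "- \<alpha> / 2 = - \<nu>" by (simp add: \<nu>_def)
  have K: "K > 0" using assms pos by (simp add: K_def)
  \<comment> \<open>The hypothesis on the data says that the first factor is below 1, which is the
    bound on \<open>K\<close> that the root lemma asks for.\<close>
  have "K = k * \<rho> * L * (T0 - Tm) * G2 / (q0\<^sup>2 * G1) * (1 / G1)\<^sup>2"
    by (simp add: K_def power2_eq_square power3_eq_cube)
  also have "\<dots> < 1 * (1 / G1)\<^sup>2"
    using assms(8) pos by (intro mult_strict_right_mono) (auto simp: G1_def G2_def \<nu>_def)
  finally have K_less: "K < (1 / Gamma (1 - \<nu>))\<^sup>2" by (simp add: G1_def)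
  have eq: "(1 - wright (- \<xi>) (- \<nu>) 1) / \<xi> = K * (1 / mainardi \<nu> \<xi>)
      \<longleftrightarrow> (1 - wright (- \<xi>) (- \<nu>) 1) / \<xi> * mainardi \<nu> \<xi> = K" if "\<xi> > 0" for \<xi>
    using mainardi_pos[OF \<nu>, of \<xi>] that by (simp add: field_simps)
  have ex1: "\<exists>!\<xi>. \<xi> > 0 \<and> (1 - wright (- \<xi>) (- \<nu>) 1) / \<xi> = K * (1 / mainardi \<nu> \<xi>)"
    using wright_mainardi_equation_unique[OF \<nu> K K_less] eq by (smt (verit, ccfv_SIG))
  have sol: "stefan_sol \<alpha> \<rho> k c L Tm T0 q0
        (\<lambda>x t. T0 - (T0 - Tm) / (1 - wright (- \<xi>) (- \<nu>) 1) * (1 - wright (- (x / (lam * t powr \<nu>))) (- \<nu>) 1))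
        (\<lambda>t. lam * \<xi> * t powr \<nu>) \<and>
      lam\<^sup>2 = k * (T0 - Tm) * G1 / (\<rho> * L * G2) * mainardi \<nu> \<xi> / (\<xi> * (1 - wright (- \<xi>) (- \<nu>) 1))"
    if \<xi>: "\<xi> > 0" "(1 - wright (- \<xi>) (- \<nu>) 1) / \<xi> = K * (1 / mainardi \<nu> \<xi>)"
      and c: "c = L * G2 / ((T0 - Tm) * G1) * (\<xi> / mainardi \<nu> \<xi>) * (1 - wright (- \<xi>) (- \<nu>) 1)"
      and lam: "lam = sqrt (k / (\<rho> * c))" for \<xi> c lam
  proof -
    define f where "f = 1 - wright (- \<xi>) (- \<nu>) 1"
    define M where "M = mainardi \<nu> \<xi>"
    have fM: "f > 0" "M > 0"
      using wright_complement_pos[OF \<nu> \<xi>(1)] mainardi_pos[OF \<nu>, of \<xi>] \<xi>(1) by (auto simp: f_def M_def)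
    have c': "c = L * G2 / (\<theta> * G1) * (\<xi> / M) * f" using c by (simp add: f_def M_def \<theta>_def)
    have "c > 0" unfolding c' using assms pos fM \<xi> by simp
    then have lam2: "lam\<^sup>2 = k / (\<rho> * c)" and "lam > 0" using lam assms by auto
    \<comment> \<open>This is the front balance solved for \<open>lam\<^sup>2\<close>; the formula
      for \<open>c\<close> is the one that produces it.\<close>
    have lam2': "lam\<^sup>2 = k * \<theta> * G1 / (\<rho> * L * G2) * M / (\<xi> * f)"
      unfolding lam2 c' using assms pos fM \<xi> by (simp add: field_simps)
    have fK: "f * M = K * \<xi>"
      using \<xi> fM by (simp add: f_def[symmetric] M_def[symmetric] field_simps)
    \<comment> \<open>\<open>lam\<close> is a square root, so the flux condition is checked in
      squared form, where the equation for \<xi> enters as \<open>fK\<close>; positivity of both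
      sides removes the square.\<close>
    have "(k * (\<theta> / f) / (G1 * lam))\<^sup>2 = k\<^sup>2 * \<theta>\<^sup>2 / (f\<^sup>2 * G1\<^sup>2 * lam\<^sup>2)"
      by (simp add: power_mult_distrib power_divide)
    also have "\<dots> = k * \<theta> * \<rho> * L * G2 / (G1 ^ 3) * (\<xi> / (f * M))"
      unfolding lam2' using assms pos fM \<xi> by (simp add: field_simps power2_eq_square power3_eq_cube)
    also have "\<dots> = q0\<^sup>2"
      unfolding fK K_def \<theta>_def[symmetric] using assms pos fM \<xi> by (simp add: field_simps)
    finally have flux: "k * (\<theta> / f) / (G1 * lam) = q0"
      using assms pos fM \<open>lam > 0\<close> by (subst (asm) power2_eq_iff_nonneg) auto
    have "stefan_sol \<alpha> \<rho> k c L Tm T0 q0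
        (\<lambda>x t. T0 - \<theta> / f * (1 - wright (- (x / (lam * t powr \<nu>))) (- \<nu>) 1)) (\<lambda>t. lam * \<xi> * t powr \<nu>)"
    proof (rule stefan_sol_similarity[OF assms(1,2) \<open>c > 0\<close> \<open>lam > 0\<close> \<xi>(1) lam2, folded \<nu>_def])
      show "\<theta> / f * (1 - wright (- \<xi>) (- \<nu>) 1) = T0 - Tm"
        using fM by (simp add: f_def[symmetric] \<theta>_def)
      show "k * (\<theta> / f) * mainardi \<nu> \<xi> = \<rho> * L * lam\<^sup>2 * \<xi> * Gamma (1 + \<nu>) / Gamma (1 - \<nu>)"
        unfolding lam2' M_def[symmetric] G1_def[symmetric] G2_def[symmetric]
        using assms pos fM \<xi> by (simp add: field_simps)
      show "k * (\<theta> / f) / (Gamma (1 - \<nu>) * lam) = q0"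
        using flux unfolding G1_def .
    qed
    then show ?thesis using lam2' by (simp add: f_def M_def \<theta>_def)
  qed
  show ?thesis
    unfolding neg_half \<nu>_def[symmetric] G1_def[symmetric] G2_def[symmetric] K_def[symmetric]
    using ex1 sol by blast
qed

end
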